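(* (Logical relations lemma.) For every type-variable context $\Delta$, typing context $\Gamma$, term $e$, and types $A$, $C$ of the language $\mathrm{DM}$: 1. if $\Delta\mid\Gamma\vdash e:C\,!\,n$ then $\underline\Delta,\underline\Gamma\vdash\underline e:\mathrm F_C\,(e^\star\,\mathrm s_\Gamma)$; 2. if $\Delta\mid\Gamma\vdash e:A\,!\,\tau$ then $\underline\Delta,\underline\Gamma\vdash\underline e:\mathsf{Pure}\ \underline A\ (e^\star\,\mathrm s_\Gamma)$, where the conclusions are typing judgments of $\mathrm{EMF}^\star$.
   Context: **The language $\mathrm{DM}$.** Effects $\epsilon\in\{n,\tau\}$ ($n$ non-effectful, $\tau$ an abstract monad). Types: $A::=X\mid b\mid A\xrightarrow{n}A\mid A+A\mid A\times A$; $H::=A\mid C$; $C::=H\xrightarrow{\tau}A\mid H\xrightarrow{n}C\mid C\times C$, where $X$ ranges over type variables and $b$ over base types. Terms: $e::=x\mid e\,e\mid\lambda x{:}H.e\mid\kappa(e,\dots,e)\mid(e,e)\mid\mathbf{fst}(e)\mid\mathbf{snd}(e)\mid\mathbf{inl}(e)\mid\mathbf{inr}(e)\mid\mathbf{case}\,e\,\mathbf{inl}\,x{:}A.e;\mathbf{inr}\,y{:}A.e\mid\mathbf{return}_\tau\,e\mid\mathbf{bind}_\tau\,e\,\mathbf{to}\,x\,\mathbf{in}\,e$, with $\kappa$ constants. Judgments are $\Delta\mid\Gamma\vdash e:H\,!\,n$ and $\Delta\mid\Gamma\vdash e:A\,!\,\tau$; $\Delta$ is a finite sequence of type variables, $\Gamma$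 a list of bindings $x{:}H$ with distinct variables and types over $\Delta$. All types appearing in rules must be well formed by the grammar. Rules: variables ($x{:}H\in\Gamma$ gives $x:H!n$); constants ($\kappa:b_1,\dots,b_n\to b$ and $e_i:b_i!n$ give $\kappa(e_1,\dots,e_n):b!n$); $\Gamma,x{:}H\vdash e:H'!\epsilon$ gives $\lambda x{:}H.e:H\xrightarrow{\epsilon}H'\,!\,n$; $f:H\xrightarrow{\epsilon}H'!n$ and $e:H!n$ give $f\,e:H'!\epsilon$; $e:H!n$, $e':H'!n$ give $(e,e'):H\times H'!n$; projections from $e:H\times H'!n$ have effect $n$; $e:A!n$ gives $\mathbf{inl}(e):A+A'!n$ (similarly $\mathbf{inr}$); $e:A+A'!n$, $\Gamma,x{:}A\vdash e_1:H!\epsilon$, $\Gamma,y{:}A'\vdash e_2:H!\epsilon$ give $\mathbf{case}\,e\,\mathbf{inl}\,x{:}A.e_1;\mathbf{inr}\,y{:}A'.e_2:H!\epsilon$; $e:A!n$ gives $\mathbf{return}_\tau\,e:A!\tau$; $e_1:A!\tau$ and $\Gamma,x{:}A\vdash e_2:A'!\tau$ give $\mathbf{bind}_\tau\,e_1\,\mathbf{to}\,x\,\mathbf{in}\,e_2:A'!\tau$. **The $\star$-translation.** On types: $A^\star$ is $A$ with every $\xrightarrow{n}$ replaced by $\to$; $(H\xrightarrow{n}C)^\star=H^\star\to C^\star$; $(C\times C')^\star=C^\star\times C'^\star$; $(H\xrightarrow{\tau}A)^\star=H^\star\to(A^\star\to\mathsf{Type}_0)\to\mathsf{Type}_0$.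 On terms (defined over typing derivations): $(\mathbf{return}_\tau\,e)^\star=\lambda p{:}(A^\star\to\mathsf{Type}_0).\,p\,e^\star$ when $e:A!n$; $(\mathbf{bind}_\tau\,e_1\,\mathbf{to}\,x\,\mathbf{in}\,e_2)^\star=\lambda p{:}(A'^\star\to\mathsf{Type}_0).\,e_1^\star\,(\lambda x{:}A^\star.\,e_2^\star\,p)$ when $e_1:A!\tau$, $e_2:A'!\tau$; all other constructs homomorphically ($(\lambda x{:}H.e)^\star=\lambda x{:}H^\star.e^\star$, etc.). **Elaboration of types.** $\underline A=A^\star$. For $wp:C^\star$, $\mathrm F_C\,wp$ is defined by: $\mathrm F_{C\times C'}\,wp=\mathrm F_C(\mathsf{fst}\,wp)\times\mathrm F_{C'}(\mathsf{snd}\,wp)$; $\mathrm F_{C\xrightarrow{\epsilon}H}\,wp=w'{:}C^\star\to\mathrm F_C\,w'\to\mathrm G^\epsilon_H(wp\,w')$; $\mathrm F_{A\xrightarrow{\epsilon}H}\,wp=x{:}\underline A\to\mathrm G^\epsilon_H(wp\,x)$; where $\mathrm G^n_C(wp)=\mathrm F_C\,wp$ and $\mathrm G^\tau_A(wp)=\mathsf{Pure}\,\underline A\,wp$. **Contexts.** $\underline\Delta=X_1{:}\mathsf{Type}_0,\dots,X_m{:}\mathsf{Type}_0$ for $\Delta=X_1,\dots,X_m$. $\underline\Gamma$ replaces each $x{:}A$ by $x{:}\underline A$ and each $y{:}C$ by $y^w{:}C^\star,\ y{:}\mathrm F_C\,y^w$ ($y^w$ fresh). $\mathrm s_\Gamma$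 is the substitution replacing $y$ by $y^w$ for each $y{:}C$ in $\Gamma$; $e^\star\,\mathrm s_\Gamma$ denotes its application. **Elaboration of terms** (over typing derivations, in context $\Gamma$): $\underline x=x$; $\underline{\kappa(e_1,\dots,e_n)}=\kappa\,\underline{e_1}\cdots\underline{e_n}$; $\underline{\lambda x{:}A.e}=\lambda x{:}\underline A.\underline e$; $\underline{\lambda x{:}C.e}=\lambda x^w{:}C^\star.\lambda x{:}\mathrm F_C\,x^w.\underline e$; $\mathbf{fst},\mathbf{snd},\mathbf{inl},\mathbf{inr}$ and pairs homomorphically; $\underline{e_1e_2}=\underline{e_1}\,\underline{e_2}$ if $e_2:A!n$; $\underline{e_1e_2}=\underline{e_1}\,(e_2^\star\,\mathrm s_\Gamma)\,\underline{e_2}$ if $e_2:C!n$; $\mathbf{case}\,e\,\mathbf{inl}\,x{:}A_1.e_1;\mathbf{inr}\,y{:}A_2.e_2$ elaborates to $\mathsf{case}(\underline e)\,x.\underline{e_1}\,y.\underline{e_2}$ (non-dependent) if the branches have type $A!\epsilon$, and to $\mathsf{case}_{t}(\underline e\ \mathsf{as}\ z)\,x.\underline{e_1}\,y.\underline{e_2}$ with $t=\mathrm F_C(\mathsf{case}(z)\,x.(e_1^\star\,\mathrm s_\Gamma)\,y.(e_2^\star\,\mathrm s_\Gamma))$ if they have type $C!n$; $\underline{\mathbf{return}_\tau\,e}=\mathsf{Pure}.\mathsf{return}\,\underline A\,\underline e$; $\underline{\mathbf{bind}_\tau\,e_1\,\mathbf{to}\,x{:}A\,\mathbf{in}\,e_2}=\mathsf{Pure}.\mathsf{bind}\,\underline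 A\,\underline{A'}\,(e_1^\star\,\mathrm s_\Gamma)\,\underline{e_1}\,(\lambda x{:}A^\star.\,e_2^\star\,\mathrm s_\Gamma)\,x.\underline{e_2}$, where $e_2:A'!\tau$. **Target $\mathrm{EMF}^\star$ (relevant part).** A dependently typed $\lambda$-calculus with predicative universes $\mathsf{Type}_0:\mathsf{Type}_1:\cdots$, dependent products $x{:}t\to c$, non-dependent pairs and sums with dependent case analysis $\mathsf{case}_t(e\ \mathsf{as}\ y)\,x.e_1\,x.e_2$ (into types of any universe), and the base types and constants of $\mathrm{DM}$. Computation types are $c::=\mathsf{Tot}\,t\mid\mathsf{Pure}\,t\,wp$ (and user-defined effects, irrelevant here), with $t:\mathsf{Type}_0$, $wp:(t\to\mathsf{Type}_0)\to\mathsf{Type}_0$; $t\to t'$ means $t\to\mathsf{Tot}\,t'$ and $e:t$ means $e:\mathsf{Tot}\,t$. Typing: standard rules for total terms, abstraction ($\lambda x{:}t.e:x{:}t\to c$ if $\Gamma,x{:}t\vdash e:c$) and application ($e_1e_2:c[e_2/x]$); case analysis with branches $\mathsf{Pure}\,t\,wp_1$, $\mathsf{Pure}\,t\,wp_2$ has type $\mathsf{Pure}\,t\,(\mathsf{case}(e)\,x.wp_1\,x.wp_2)$; $e:\mathsf{Tot}\,t$ gives $\mathsf{Pure}.\mathsf{return}\,t\,e:\mathsf{Pure}\,t\,(\lambda p.p\,e)$; $e_1:\mathsf{Pure}\,t_1\,wp_1$, $wp_2:t_1\to(t_2\to\mathsf{Type}_0)\to\mathsf{Type}_0$ and $\Gamma,x{:}t_1\vdash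 e_2:\mathsf{Pure}\,t_2\,(wp_2\,x)$ give $\mathsf{Pure}.\mathsf{bind}\,t_1\,t_2\,wp_1\,e_1\,wp_2\,x.e_2:\mathsf{Pure}\,t_2\,(\lambda p.\,wp_1(\lambda x.\,wp_2\,x\,p))$. Subsumption along subtyping: $\mathsf{Tot}\,t'<:\mathsf{Tot}\,t$ if $t'<:t$; $\mathsf{Pure}\,t'\,wp'<:\mathsf{Pure}\,t\,wp$ if $t'<:t$ and $\models\forall p.\,wp\,p\Rightarrow wp'\,p$; products contravariant in the domain and covariant in the codomain; $t'<:t$ if one reduces to the other. Validity $\models$ is a proof-irrelevant classical higher-order logic with equality containing reduction and function extensionality. The effect signature is arbitrary and omitted. *)

theory Defs
  imports Main
begin

section \<open>The source language DM\<close>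

text \<open>
  Both languages use de Bruijn indices. Type variables are never bound inside DM types or terms,
  so a type-variable context \<open>\<Delta>\<close> is given by its length and \<open>TyVar j\<close> is its \<open>j\<close>-th variable counted
  from the right. A typing context \<open>\<Gamma>\<close> is a list of types whose head is the most recent binding.
\<close>

datatype eff = Eff_n | Eff_tau

datatype 'b ty =
    TyVar nat
  | TyBase 'b
  | TyArr eff "'b ty" "'b ty"
  | TySum "'b ty" "'b ty"
  | TyProd "'b ty" "'b ty"

text \<open>The grammatical categories \<open>A\<close>, \<open>C\<close> and \<open>H\<close>. The categories \<open>A\<close> and \<open>C\<close> are disjoint.\<close>

primrec is_A :: "'b ty \<Rightarrow> bool" where
  "is_A (TyVar j) = True"
| "is_A (TyBase b) = True"
| "is_A (TyArr \<epsilon> T U) = (\<epsilon> = Eff_n \<and> is_A T \<and> is_A U)"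
| "is_A (TySum T U) = (is_A T \<and> is_A U)"
| "is_A (TyProd T U) = (is_A T \<and> is_A U)"

primrec is_C :: "'b ty \<Rightarrow> bool" where
  "is_C (TyVar j) = False"
| "is_C (TyBase b) = False"
| "is_C (TyArr \<epsilon> T U) =
     ((is_A T \<or> is_C T) \<and> (case \<epsilon> of Eff_n \<Rightarrow> is_C U | Eff_tau \<Rightarrow> is_A U))"
| "is_C (TySum T U) = False"
| "is_C (TyProd T U) = (is_C T \<and> is_C U)"

primrec tvars :: "'b ty \<Rightarrow> nat set" where
  "tvars (TyVar j) = {j}"
| "tvars (TyBase b) = {}"
| "tvars (TyArr \<epsilon> T U) = tvars T \<union> tvars U"
| "tvars (TySum T U) = tvars T \<union> tvars U"
| "tvars (TyProd T U) = tvars T \<union> tvars U"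

definition wf_A :: "nat \<Rightarrow> 'b ty \<Rightarrow> bool" where
  "wf_A \<Delta> T \<longleftrightarrow> is_A T \<and> tvars T \<subseteq> {..<\<Delta>}"

definition wf_H :: "nat \<Rightarrow> 'b ty \<Rightarrow> bool" where
  "wf_H \<Delta> T \<longleftrightarrow> (is_A T \<or> is_C T) \<and> tvars T \<subseteq> {..<\<Delta>}"

text \<open>Judgments have the form \<open>H ! n\<close> or \<open>A ! \<tau>\<close>.\<close>

definition wf_result :: "nat \<Rightarrow> 'b ty \<Rightarrow> eff \<Rightarrow> bool" where
  "wf_result \<Delta> H \<epsilon> \<longleftrightarrow> (case \<epsilon> of Eff_n \<Rightarrow> wf_H \<Delta> H | Eff_tau \<Rightarrow> wf_A \<Delta> H)"

definition wf_ctx :: "nat \<Rightarrow> 'b ty list \<Rightarrow> bool" where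
  "wf_ctx \<Delta> \<Gamma> \<longleftrightarrow> (\<forall>H\<in>set \<Gamma>. wf_H \<Delta> H)"

datatype ('b, 'k) exp =
    EVar nat
  | EApp "('b, 'k) exp" "('b, 'k) exp"
  | ELam "'b ty" "('b, 'k) exp"
  | EConst 'k "('b, 'k) exp list"
  | EPair "('b, 'k) exp" "('b, 'k) exp"
  | EFst "('b, 'k) exp"
  | ESnd "('b, 'k) exp"
  | EInl "('b, 'k) exp"
  | EInr "('b, 'k) exp"
  | ECase "('b, 'k) exp" "'b ty" "('b, 'k) exp" "'b ty" "('b, 'k) exp"
  | EReturn "('b, 'k) exp"
  | EBind "('b, 'k) exp" "('b, 'k) exp"

text \<open>
  The translations are defined over typing derivations, not over terms. A derivation is represented
  by the tree of its rule instances; a node records the types and effects instantiating the rule.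
\<close>

datatype ('b, 'k) deriv =
    DVar nat
  | DConst 'k "('b, 'k) deriv list"
  | DLam "'b ty" eff "'b ty" "('b, 'k) deriv"
  | DApp "'b ty" eff "'b ty" "('b, 'k) deriv" "('b, 'k) deriv"
  | DPair "'b ty" "'b ty" "('b, 'k) deriv" "('b, 'k) deriv"
  | DFst "'b ty" "'b ty" "('b, 'k) deriv"
  | DSnd "'b ty" "'b ty" "('b, 'k) deriv"
  | DInl "'b ty" "'b ty" "('b, 'k) deriv"
  | DInr "'b ty" "'b ty" "('b, 'k) deriv"
  | DCase "'b ty" "'b ty" "'b ty" eff "('b, 'k) deriv" "('b, 'k) deriv" "('b, 'k) deriv"
  | DReturn "'b ty" "('b, 'k) deriv"
  | DBind "'b ty" "'b ty" "('b, 'k) deriv" "('b, 'k) deriv"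

text \<open>
  \<open>dm_derives \<Sigma> D \<Delta> \<Gamma> e H \<epsilon>\<close>: the tree \<open>D\<close> is a derivation of \<open>\<Delta> | \<Gamma> \<turnstile> e : H ! \<epsilon>\<close>.
  The signature \<open>\<Sigma>\<close> gives each constant its argument base types and its result base type.
\<close>

inductive dm_derives ::
  "('k \<Rightarrow> 'b list \<times> 'b) \<Rightarrow> ('b, 'k) deriv \<Rightarrow> nat \<Rightarrow> 'b ty list \<Rightarrow> ('b, 'k) exp \<Rightarrow> 'b ty \<Rightarrow> eff \<Rightarrow> bool"
  for \<Sigma> :: "'k \<Rightarrow> 'b list \<times> 'b"
where
  dm_var:
  "\<lbrakk> wf_ctx \<Delta> \<Gamma>; i < length \<Gamma> \<rbrakk> \<Longrightarrow> dm_derives \<Sigma> (DVar i) \<Delta> \<Gamma> (EVar i) (\<Gamma> ! i) Eff_n"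
| dm_const:
  "\<lbrakk> wf_ctx \<Delta> \<Gamma>; \<Sigma> \<kappa> = (bs, b); length es = length bs; length Ds = length bs;
     \<forall>i<length bs. dm_derives \<Sigma> (Ds ! i) \<Delta> \<Gamma> (es ! i) (TyBase (bs ! i)) Eff_n \<rbrakk>
   \<Longrightarrow> dm_derives \<Sigma> (DConst \<kappa> Ds) \<Delta> \<Gamma> (EConst \<kappa> es) (TyBase b) Eff_n"
| dm_lam:
  "\<lbrakk> wf_H \<Delta> (TyArr \<epsilon> H H'); dm_derives \<Sigma> D \<Delta> (H # \<Gamma>) e H' \<epsilon> \<rbrakk>
   \<Longrightarrow> dm_derives \<Sigma> (DLam H \<epsilon> H' D) \<Delta> \<Gamma> (ELam H e) (TyArr \<epsilon> H H') Eff_n"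
| dm_app:
  "\<lbrakk> wf_H \<Delta> (TyArr \<epsilon> H H');
     dm_derives \<Sigma> D1 \<Delta> \<Gamma> f (TyArr \<epsilon> H H') Eff_n; dm_derives \<Sigma> D2 \<Delta> \<Gamma> e H Eff_n \<rbrakk>
   \<Longrightarrow> dm_derives \<Sigma> (DApp H \<epsilon> H' D1 D2) \<Delta> \<Gamma> (EApp f e) H' \<epsilon>"
| dm_pair:
  "\<lbrakk> wf_H \<Delta> (TyProd H H');
     dm_derives \<Sigma> D1 \<Delta> \<Gamma> e1 H Eff_n; dm_derives \<Sigma> D2 \<Delta> \<Gamma> e2 H' Eff_n \<rbrakk>
   \<Longrightarrow> dm_derives \<Sigma> (DPair H H' D1 D2) \<Delta> \<Gamma> (EPair e1 e2) (TyProd H H') Eff_n"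
| dm_fst:
  "\<lbrakk> wf_H \<Delta> (TyProd H H'); dm_derives \<Sigma> D \<Delta> \<Gamma> e (TyProd H H') Eff_n \<rbrakk>
   \<Longrightarrow> dm_derives \<Sigma> (DFst H H' D) \<Delta> \<Gamma> (EFst e) H Eff_n"
| dm_snd:
  "\<lbrakk> wf_H \<Delta> (TyProd H H'); dm_derives \<Sigma> D \<Delta> \<Gamma> e (TyProd H H') Eff_n \<rbrakk>
   \<Longrightarrow> dm_derives \<Sigma> (DSnd H H' D) \<Delta> \<Gamma> (ESnd e) H' Eff_n"
| dm_inl:
  "\<lbrakk> wf_A \<Delta> A; wf_A \<Delta> A'; dm_derives \<Sigma> D \<Delta> \<Gamma> e A Eff_n \<rbrakk>
   \<Longrightarrow> dm_derives \<Sigma> (DInl A A' D) \<Delta> \<Gamma> (EInl e) (TySum A A') Eff_n"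
| dm_inr:
  "\<lbrakk> wf_A \<Delta> A; wf_A \<Delta> A'; dm_derives \<Sigma> D \<Delta> \<Gamma> e A' Eff_n \<rbrakk>
   \<Longrightarrow> dm_derives \<Sigma> (DInr A A' D) \<Delta> \<Gamma> (EInr e) (TySum A A') Eff_n"
| dm_case:
  "\<lbrakk> wf_A \<Delta> A; wf_A \<Delta> A'; wf_result \<Delta> H \<epsilon>;
     dm_derives \<Sigma> D \<Delta> \<Gamma> e (TySum A A') Eff_n;
     dm_derives \<Sigma> D1 \<Delta> (A # \<Gamma>) e1 H \<epsilon>; dm_derives \<Sigma> D2 \<Delta> (A' # \<Gamma>) e2 H \<epsilon> \<rbrakk>
   \<Longrightarrow> dm_derives \<Sigma> (DCase A A' H \<epsilon> D D1 D2) \<Delta> \<Gamma> (ECase e A e1 A' e2) H \<epsilon>"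
| dm_return:
  "\<lbrakk> wf_A \<Delta> A; dm_derives \<Sigma> D \<Delta> \<Gamma> e A Eff_n \<rbrakk>
   \<Longrightarrow> dm_derives \<Sigma> (DReturn A D) \<Delta> \<Gamma> (EReturn e) A Eff_tau"
| dm_bind:
  "\<lbrakk> wf_A \<Delta> A; wf_A \<Delta> A';
     dm_derives \<Sigma> D1 \<Delta> \<Gamma> e1 A Eff_tau; dm_derives \<Sigma> D2 \<Delta> (A # \<Gamma>) e2 A' Eff_tau \<rbrakk>
   \<Longrightarrow> dm_derives \<Sigma> (DBind A A' D1 D2) \<Delta> \<Gamma> (EBind e1 e2) A' Eff_tau"


section \<open>The target language EMF*\<close>

subsection \<open>Syntax\<close>

text \<open>
  Terms and types share one syntactic class. One variable is bound in the second argument of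
  \<open>Pi\<close> and \<open>Lam\<close>, in the first (the type annotation), third and fourth argument of \<open>Case\<close>, and in
  the last argument of \<open>PBind\<close>:
  \<open>Case t e e1 e2\<close> is \<open>case\<^sub>t (e as y) x.e1 x.e2\<close>, and \<open>PBind t1 t2 w1 e1 w2 e2\<close> is
  \<open>Pure.bind t1 t2 w1 e1 w2 x.e2\<close>.
\<close>

datatype ('b, 'k) tm =
    Var nat
  | Univ nat
  | Base 'b
  | Cst 'k
  | Pi "('b, 'k) tm" "('b, 'k) cty"
  | Lam "('b, 'k) tm" "('b, 'k) tm"
  | App "('b, 'k) tm" "('b, 'k) tm"
  | Prod "('b, 'k) tm" "('b, 'k) tm"
  | Pair "('b, 'k) tm" "('b, 'k) tm"
  | Fst "('b, 'k) tm"
  | Snd "('b, 'k) tm"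
  | Sum "('b, 'k) tm" "('b, 'k) tm"
  | Inl "('b, 'k) tm"
  | Inr "('b, 'k) tm"
  | Case "('b, 'k) tm" "('b, 'k) tm" "('b, 'k) tm" "('b, 'k) tm"
  | PReturn "('b, 'k) tm" "('b, 'k) tm"
  | PBind "('b, 'k) tm" "('b, 'k) tm" "('b, 'k) tm" "('b, 'k) tm" "('b, 'k) tm" "('b, 'k) tm"
  | Bot
  | Eq "('b, 'k) tm" "('b, 'k) tm" "('b, 'k) tm"
and ('b, 'k) cty =
    Tot "('b, 'k) tm"
  | Pure "('b, 'k) tm" "('b, 'k) tm"

definition up_ren :: "(nat \<Rightarrow> nat) \<Rightarrow> nat \<Rightarrow> nat" where
  "up_ren r = case_nat 0 (\<lambda>i. Suc (r i))"

primrec ren :: "(nat \<Rightarrow> nat) \<Rightarrow> ('b, 'k) tm \<Rightarrow> ('b, 'k) tm"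
  and ren_c :: "(nat \<Rightarrow> nat) \<Rightarrow> ('b, 'k) cty \<Rightarrow> ('b, 'k) cty"
where
  "ren r (Var i) = Var (r i)"
| "ren r (Univ i) = Univ i"
| "ren r (Base b) = Base b"
| "ren r (Cst \<kappa>) = Cst \<kappa>"
| "ren r (Pi t c) = Pi (ren r t) (ren_c (up_ren r) c)"
| "ren r (Lam t e) = Lam (ren r t) (ren (up_ren r) e)"
| "ren r (App e1 e2) = App (ren r e1) (ren r e2)"
| "ren r (Prod t1 t2) = Prod (ren r t1) (ren r t2)"
| "ren r (Pair e1 e2) = Pair (ren r e1) (ren r e2)"
| "ren r (Fst e) = Fst (ren r e)"
| "ren r (Snd e) = Snd (ren r e)"
| "ren r (Sum t1 t2) = Sum (ren r t1) (ren r t2)"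
| "ren r (Inl e) = Inl (ren r e)"
| "ren r (Inr e) = Inr (ren r e)"
| "ren r (Case t e e1 e2) = Case (ren (up_ren r) t) (ren r e) (ren (up_ren r) e1) (ren (up_ren r) e2)"
| "ren r (PReturn t e) = PReturn (ren r t) (ren r e)"
| "ren r (PBind t1 t2 w1 e1 w2 e2) =
     PBind (ren r t1) (ren r t2) (ren r w1) (ren r e1) (ren r w2) (ren (up_ren r) e2)"
| "ren r Bot = Bot"
| "ren r (Eq t e1 e2) = Eq (ren r t) (ren r e1) (ren r e2)"
| "ren_c r (Tot t) = Tot (ren r t)"
| "ren_c r (Pure t w) = Pure (ren r t) (ren r w)"

abbreviation lift :: "('b, 'k) tm \<Rightarrow> ('b, 'k) tm" where
  "lift \<equiv> ren Suc"

definition up_sub :: "(nat \<Rightarrow> ('b, 'k) tm) \<Rightarrow> nat \<Rightarrow> ('b, 'k) tm" where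
  "up_sub s = case_nat (Var 0) (\<lambda>i. lift (s i))"

primrec sub :: "(nat \<Rightarrow> ('b, 'k) tm) \<Rightarrow> ('b, 'k) tm \<Rightarrow> ('b, 'k) tm"
  and sub_c :: "(nat \<Rightarrow> ('b, 'k) tm) \<Rightarrow> ('b, 'k) cty \<Rightarrow> ('b, 'k) cty"
where
  "sub s (Var i) = s i"
| "sub s (Univ i) = Univ i"
| "sub s (Base b) = Base b"
| "sub s (Cst \<kappa>) = Cst \<kappa>"
| "sub s (Pi t c) = Pi (sub s t) (sub_c (up_sub s) c)"
| "sub s (Lam t e) = Lam (sub s t) (sub (up_sub s) e)"
| "sub s (App e1 e2) = App (sub s e1) (sub s e2)"
| "sub s (Prod t1 t2) = Prod (sub s t1) (sub s t2)"
| "sub s (Pair e1 e2) = Pair (sub s e1) (sub s e2)"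
| "sub s (Fst e) = Fst (sub s e)"
| "sub s (Snd e) = Snd (sub s e)"
| "sub s (Sum t1 t2) = Sum (sub s t1) (sub s t2)"
| "sub s (Inl e) = Inl (sub s e)"
| "sub s (Inr e) = Inr (sub s e)"
| "sub s (Case t e e1 e2) = Case (sub (up_sub s) t) (sub s e) (sub (up_sub s) e1) (sub (up_sub s) e2)"
| "sub s (PReturn t e) = PReturn (sub s t) (sub s e)"
| "sub s (PBind t1 t2 w1 e1 w2 e2) =
     PBind (sub s t1) (sub s t2) (sub s w1) (sub s e1) (sub s w2) (sub (up_sub s) e2)"
| "sub s Bot = Bot"
| "sub s (Eq t e1 e2) = Eq (sub s t) (sub s e1) (sub s e2)"
| "sub_c s (Tot t) = Tot (sub s t)"
| "sub_c s (Pure t w) = Pure (sub s t) (sub s w)"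

text \<open>\<open>inst e\<close> is the substitution of \<open>e\<close> for the most recent variable.\<close>

definition inst :: "('b, 'k) tm \<Rightarrow> nat \<Rightarrow> ('b, 'k) tm" where
  "inst e = case_nat e Var"

text \<open>
  \<open>inst_under f\<close> replaces the most recent variable \<open>y\<close> by \<open>f x\<close>, where \<open>x\<close> is a variable
  taking the place of \<open>y\<close> in the context.
\<close>

definition inst_under :: "(('b, 'k) tm \<Rightarrow> ('b, 'k) tm) \<Rightarrow> nat \<Rightarrow> ('b, 'k) tm" where
  "inst_under f = case_nat (f (Var 0)) (\<lambda>i. Var (Suc i))"

definition arr :: "('b, 'k) tm \<Rightarrow> ('b, 'k) tm \<Rightarrow> ('b, 'k) tm" where
  "arr t t' = Pi t (Tot (lift t'))"

definition case_nd :: "('b, 'k) tm \<Rightarrow> ('b, 'k) tm \<Rightarrow> ('b, 'k) tm \<Rightarrow> ('b, 'k) tm \<Rightarrow> ('b, 'k) tm" where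
  "case_nd t e e1 e2 = Case (lift t) e e1 e2"

definition pred_ty :: "('b, 'k) tm \<Rightarrow> ('b, 'k) tm" where
  "pred_ty t = arr t (Univ 0)"

definition wp_ty :: "('b, 'k) tm \<Rightarrow> ('b, 'k) tm" where
  "wp_ty t = arr (pred_ty t) (Univ 0)"

subsection \<open>Reduction\<close>

inductive red :: "('b, 'k) tm \<Rightarrow> ('b, 'k) tm \<Rightarrow> bool"
  and red_c :: "('b, 'k) cty \<Rightarrow> ('b, 'k) cty \<Rightarrow> bool"
where
  red_beta: "red (App (Lam t e) e') (sub (inst e') e)"
| red_fst: "red (Fst (Pair e1 e2)) e1"
| red_snd: "red (Snd (Pair e1 e2)) e2"
| red_inl: "red (Case t (Inl e) e1 e2) (sub (inst e) e1)"
| red_inr: "red (Case t (Inr e) e1 e2) (sub (inst e) e2)"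
| red_bind: "red (PBind t1 t2 w1 (PReturn t e1) w2 e2) (sub (inst e1) e2)"
| red_Pi1: "red t t' \<Longrightarrow> red (Pi t c) (Pi t' c)"
| red_Pi2: "red_c c c' \<Longrightarrow> red (Pi t c) (Pi t c')"
| red_Lam1: "red t t' \<Longrightarrow> red (Lam t e) (Lam t' e)"
| red_Lam2: "red e e' \<Longrightarrow> red (Lam t e) (Lam t e')"
| red_App1: "red e1 e1' \<Longrightarrow> red (App e1 e2) (App e1' e2)"
| red_App2: "red e2 e2' \<Longrightarrow> red (App e1 e2) (App e1 e2')"
| red_Prod1: "red t1 t1' \<Longrightarrow> red (Prod t1 t2) (Prod t1' t2)"
| red_Prod2: "red t2 t2' \<Longrightarrow> red (Prod t1 t2) (Prod t1 t2')"
| red_Pair1: "red e1 e1' \<Longrightarrow> red (Pair e1 e2) (Pair e1' e2)"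
| red_Pair2: "red e2 e2' \<Longrightarrow> red (Pair e1 e2) (Pair e1 e2')"
| red_Fst: "red e e' \<Longrightarrow> red (Fst e) (Fst e')"
| red_Snd: "red e e' \<Longrightarrow> red (Snd e) (Snd e')"
| red_Sum1: "red t1 t1' \<Longrightarrow> red (Sum t1 t2) (Sum t1' t2)"
| red_Sum2: "red t2 t2' \<Longrightarrow> red (Sum t1 t2) (Sum t1 t2')"
| red_Inl: "red e e' \<Longrightarrow> red (Inl e) (Inl e')"
| red_Inr: "red e e' \<Longrightarrow> red (Inr e) (Inr e')"
| red_Case1: "red t t' \<Longrightarrow> red (Case t e e1 e2) (Case t' e e1 e2)"
| red_Case2: "red e e' \<Longrightarrow> red (Case t e e1 e2) (Case t e' e1 e2)"
| red_Case3: "red e1 e1' \<Longrightarrow> red (Case t e e1 e2) (Case t e e1' e2)"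
| red_Case4: "red e2 e2' \<Longrightarrow> red (Case t e e1 e2) (Case t e e1 e2')"
| red_Return1: "red t t' \<Longrightarrow> red (PReturn t e) (PReturn t' e)"
| red_Return2: "red e e' \<Longrightarrow> red (PReturn t e) (PReturn t e')"
| red_Bind1: "red t1 t1' \<Longrightarrow> red (PBind t1 t2 w1 e1 w2 e2) (PBind t1' t2 w1 e1 w2 e2)"
| red_Bind2: "red t2 t2' \<Longrightarrow> red (PBind t1 t2 w1 e1 w2 e2) (PBind t1 t2' w1 e1 w2 e2)"
| red_Bind3: "red w1 w1' \<Longrightarrow> red (PBind t1 t2 w1 e1 w2 e2) (PBind t1 t2 w1' e1 w2 e2)"
| red_Bind4: "red e1 e1' \<Longrightarrow> red (PBind t1 t2 w1 e1 w2 e2) (PBind t1 t2 w1 e1' w2 e2)"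
| red_Bind5: "red w2 w2' \<Longrightarrow> red (PBind t1 t2 w1 e1 w2 e2) (PBind t1 t2 w1 e1 w2' e2)"
| red_Bind6: "red e2 e2' \<Longrightarrow> red (PBind t1 t2 w1 e1 w2 e2) (PBind t1 t2 w1 e1 w2 e2')"
| red_Eq1: "red t t' \<Longrightarrow> red (Eq t e1 e2) (Eq t' e1 e2)"
| red_Eq2: "red e1 e1' \<Longrightarrow> red (Eq t e1 e2) (Eq t e1' e2)"
| red_Eq3: "red e2 e2' \<Longrightarrow> red (Eq t e1 e2) (Eq t e1 e2')"
| red_Tot: "red t t' \<Longrightarrow> red_c (Tot t) (Tot t')"
| red_Pure1: "red t t' \<Longrightarrow> red_c (Pure t w) (Pure t' w)"
| red_Pure2: "red w w' \<Longrightarrow> red_c (Pure t w) (Pure t w')"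

subsection \<open>Typing, subtyping and validity\<close>

text \<open>
  Formulas are types: \<open>\<forall>x:t. \<phi>\<close> is \<open>Pi t (Tot \<phi>)\<close>, \<open>\<phi> \<Rightarrow> \<psi>\<close> is \<open>arr \<phi> \<psi>\<close>, conjunction is \<open>Prod\<close>,
  disjunction is \<open>Sum\<close>, falsity is \<open>Bot\<close> and equality is \<open>Eq\<close>; negation and the existential
  quantifier are the classical abbreviations. Validity only records that a formula holds: it does
  not depend on a proof term, and it is not reflected back into typing except through the
  subtyping rule for \<open>Pure\<close>.

  The judgments are \<open>ctx_ok \<Sigma> \<Gamma>\<close> (well-formed context), \<open>has_cty \<Sigma> \<Gamma> e c\<close> (\<open>\<Gamma> \<turnstile> e : c\<close>),
  \<open>cty_ok \<Sigma> \<Gamma> c i\<close> (\<open>c\<close> is a computation type of universe \<open>i\<close>), \<open>sub_ty \<Sigma> \<Gamma> t' t\<close> and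
  \<open>sub_cty \<Sigma> \<Gamma> c' c\<close> (subtyping), and \<open>valid \<Sigma> \<Gamma> \<phi>\<close> (\<open>\<Gamma> \<Turnstile> \<phi>\<close>). The head of a context is its most
  recent binding, whose type lives in the tail.
\<close>

inductive
  ctx_ok :: "('k \<Rightarrow> 'b list \<times> 'b) \<Rightarrow> ('b, 'k) tm list \<Rightarrow> bool" and
  has_cty :: "('k \<Rightarrow> 'b list \<times> 'b) \<Rightarrow> ('b, 'k) tm list \<Rightarrow> ('b, 'k) tm \<Rightarrow> ('b, 'k) cty \<Rightarrow> bool" and
  cty_ok :: "('k \<Rightarrow> 'b list \<times> 'b) \<Rightarrow> ('b, 'k) tm list \<Rightarrow> ('b, 'k) cty \<Rightarrow> nat \<Rightarrow> bool" and
  sub_ty :: "('k \<Rightarrow> 'b list \<times> 'b) \<Rightarrow> ('b, 'k) tm list \<Rightarrow> ('b, 'k) tm \<Rightarrow> ('b, 'k) tm \<Rightarrow> bool" and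
  sub_cty :: "('k \<Rightarrow> 'b list \<times> 'b) \<Rightarrow> ('b, 'k) tm list \<Rightarrow> ('b, 'k) cty \<Rightarrow> ('b, 'k) cty \<Rightarrow> bool" and
  valid :: "('k \<Rightarrow> 'b list \<times> 'b) \<Rightarrow> ('b, 'k) tm list \<Rightarrow> ('b, 'k) tm \<Rightarrow> bool"
  for \<Sigma> :: "'k \<Rightarrow> 'b list \<times> 'b"
where
  ctx_nil: "ctx_ok \<Sigma> []"
| ctx_cons: "\<lbrakk> ctx_ok \<Sigma> \<Gamma>; has_cty \<Sigma> \<Gamma> t (Tot (Univ i)) \<rbrakk> \<Longrightarrow> ctx_ok \<Sigma> (t # \<Gamma>)"

| t_var:
  "\<lbrakk> ctx_ok \<Sigma> \<Gamma>; i < length \<Gamma> \<rbrakk>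
   \<Longrightarrow> has_cty \<Sigma> \<Gamma> (Var i) (Tot (ren (\<lambda>j. j + Suc i) (\<Gamma> ! i)))"
| t_univ: "ctx_ok \<Sigma> \<Gamma> \<Longrightarrow> has_cty \<Sigma> \<Gamma> (Univ i) (Tot (Univ (Suc i)))"
| t_base: "ctx_ok \<Sigma> \<Gamma> \<Longrightarrow> has_cty \<Sigma> \<Gamma> (Base b) (Tot (Univ 0))"
| t_const:
  "\<lbrakk> ctx_ok \<Sigma> \<Gamma>; \<Sigma> \<kappa> = (bs, b) \<rbrakk>
   \<Longrightarrow> has_cty \<Sigma> \<Gamma> (Cst \<kappa>) (Tot (foldr arr (map Base bs) (Base b)))"
| t_Pi:
  "\<lbrakk> has_cty \<Sigma> \<Gamma> t (Tot (Univ i)); cty_ok \<Sigma> (t # \<Gamma>) c j \<rbrakk>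
   \<Longrightarrow> has_cty \<Sigma> \<Gamma> (Pi t c) (Tot (Univ (max i j)))"
| t_lam:
  "\<lbrakk> has_cty \<Sigma> \<Gamma> t (Tot (Univ i)); has_cty \<Sigma> (t # \<Gamma>) e c \<rbrakk>
   \<Longrightarrow> has_cty \<Sigma> \<Gamma> (Lam t e) (Tot (Pi t c))"
| t_app:
  "\<lbrakk> has_cty \<Sigma> \<Gamma> e1 (Tot (Pi t c)); has_cty \<Sigma> \<Gamma> e2 (Tot t) \<rbrakk>
   \<Longrightarrow> has_cty \<Sigma> \<Gamma> (App e1 e2) (sub_c (inst e2) c)"
| t_Prod:
  "\<lbrakk> has_cty \<Sigma> \<Gamma> t1 (Tot (Univ i)); has_cty \<Sigma> \<Gamma> t2 (Tot (Univ j)) \<rbrakk>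
   \<Longrightarrow> has_cty \<Sigma> \<Gamma> (Prod t1 t2) (Tot (Univ (max i j)))"
| t_pair:
  "\<lbrakk> has_cty \<Sigma> \<Gamma> e1 (Tot t1); has_cty \<Sigma> \<Gamma> e2 (Tot t2) \<rbrakk>
   \<Longrightarrow> has_cty \<Sigma> \<Gamma> (Pair e1 e2) (Tot (Prod t1 t2))"
| t_fst: "has_cty \<Sigma> \<Gamma> e (Tot (Prod t1 t2)) \<Longrightarrow> has_cty \<Sigma> \<Gamma> (Fst e) (Tot t1)"
| t_snd: "has_cty \<Sigma> \<Gamma> e (Tot (Prod t1 t2)) \<Longrightarrow> has_cty \<Sigma> \<Gamma> (Snd e) (Tot t2)"
| t_Sum:
  "\<lbrakk> has_cty \<Sigma> \<Gamma> t1 (Tot (Univ i)); has_cty \<Sigma> \<Gamma> t2 (Tot (Univ j)) \<rbrakk>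
   \<Longrightarrow> has_cty \<Sigma> \<Gamma> (Sum t1 t2) (Tot (Univ (max i j)))"
| t_inl:
  "\<lbrakk> has_cty \<Sigma> \<Gamma> e (Tot t1); has_cty \<Sigma> \<Gamma> t2 (Tot (Univ j)) \<rbrakk>
   \<Longrightarrow> has_cty \<Sigma> \<Gamma> (Inl e) (Tot (Sum t1 t2))"
| t_inr:
  "\<lbrakk> has_cty \<Sigma> \<Gamma> e (Tot t2); has_cty \<Sigma> \<Gamma> t1 (Tot (Univ i)) \<rbrakk>
   \<Longrightarrow> has_cty \<Sigma> \<Gamma> (Inr e) (Tot (Sum t1 t2))"
| t_case:
  "\<lbrakk> has_cty \<Sigma> \<Gamma> e (Tot (Sum t1 t2));
     has_cty \<Sigma> (Sum t1 t2 # \<Gamma>) t (Tot (Univ i));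
     has_cty \<Sigma> (t1 # \<Gamma>) e1 (Tot (sub (inst_under Inl) t));
     has_cty \<Sigma> (t2 # \<Gamma>) e2 (Tot (sub (inst_under Inr) t)) \<rbrakk>
   \<Longrightarrow> has_cty \<Sigma> \<Gamma> (Case t e e1 e2) (Tot (sub (inst e) t))"
| t_case_pure:
  "\<lbrakk> has_cty \<Sigma> \<Gamma> e (Tot (Sum t1 t2));
     has_cty \<Sigma> \<Gamma> t (Tot (Univ 0));
     has_cty \<Sigma> (t1 # \<Gamma>) e1 (Pure (lift t) w1);
     has_cty \<Sigma> (t2 # \<Gamma>) e2 (Pure (lift t) w2) \<rbrakk>
   \<Longrightarrow> has_cty \<Sigma> \<Gamma> (case_nd t e e1 e2) (Pure t (case_nd (wp_ty t) e w1 w2))"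
| t_return:
  "\<lbrakk> has_cty \<Sigma> \<Gamma> t (Tot (Univ 0)); has_cty \<Sigma> \<Gamma> e (Tot t) \<rbrakk>
   \<Longrightarrow> has_cty \<Sigma> \<Gamma> (PReturn t e) (Pure t (Lam (pred_ty t) (App (Var 0) (lift e))))"
| t_bind:
  "\<lbrakk> has_cty \<Sigma> \<Gamma> t1 (Tot (Univ 0)); has_cty \<Sigma> \<Gamma> t2 (Tot (Univ 0));
     has_cty \<Sigma> \<Gamma> e1 (Pure t1 w1);
     has_cty \<Sigma> \<Gamma> w2 (Tot (arr t1 (wp_ty t2)));
     has_cty \<Sigma> (t1 # \<Gamma>) e2 (Pure (lift t2) (App (lift w2) (Var 0))) \<rbrakk>
   \<Longrightarrow> has_cty \<Sigma> \<Gamma> (PBind t1 t2 w1 e1 w2 e2)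
         (Pure t2 (Lam (pred_ty t2)
            (App (lift w1) (Lam (lift t1) (App (App (lift (lift w2)) (Var 0)) (Var 1))))))"
| t_Bot: "ctx_ok \<Sigma> \<Gamma> \<Longrightarrow> has_cty \<Sigma> \<Gamma> Bot (Tot (Univ 0))"
| t_Eq:
  "\<lbrakk> has_cty \<Sigma> \<Gamma> t (Tot (Univ i)); has_cty \<Sigma> \<Gamma> e1 (Tot t); has_cty \<Sigma> \<Gamma> e2 (Tot t) \<rbrakk>
   \<Longrightarrow> has_cty \<Sigma> \<Gamma> (Eq t e1 e2) (Tot (Univ i))"
| t_sub:
  "\<lbrakk> has_cty \<Sigma> \<Gamma> e c'; sub_cty \<Sigma> \<Gamma> c' c; cty_ok \<Sigma> \<Gamma> c i \<rbrakk> \<Longrightarrow> has_cty \<Sigma> \<Gamma> e c"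

| c_Tot: "has_cty \<Sigma> \<Gamma> t (Tot (Univ i)) \<Longrightarrow> cty_ok \<Sigma> \<Gamma> (Tot t) i"
| c_Pure:
  "\<lbrakk> has_cty \<Sigma> \<Gamma> t (Tot (Univ 0)); has_cty \<Sigma> \<Gamma> w (Tot (wp_ty t)) \<rbrakk>
   \<Longrightarrow> cty_ok \<Sigma> \<Gamma> (Pure t w) 0"

| s_red: "red\<^sup>*\<^sup>* t' t \<or> red\<^sup>*\<^sup>* t t' \<Longrightarrow> sub_ty \<Sigma> \<Gamma> t' t"
| s_Pi:
  "\<lbrakk> sub_ty \<Sigma> \<Gamma> t t'; sub_cty \<Sigma> (t # \<Gamma>) c' c \<rbrakk> \<Longrightarrow> sub_ty \<Sigma> \<Gamma> (Pi t' c') (Pi t c)"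
| s_Tot: "sub_ty \<Sigma> \<Gamma> t' t \<Longrightarrow> sub_cty \<Sigma> \<Gamma> (Tot t') (Tot t)"
| s_Pure:
  "\<lbrakk> sub_ty \<Sigma> \<Gamma> t' t;
     valid \<Sigma> \<Gamma> (Pi (pred_ty t) (Tot (arr (App (lift w) (Var 0)) (App (lift w') (Var 0))))) \<rbrakk>
   \<Longrightarrow> sub_cty \<Sigma> \<Gamma> (Pure t' w') (Pure t w)"

| v_inhabited: "has_cty \<Sigma> \<Gamma> e (Tot \<phi>) \<Longrightarrow> valid \<Sigma> \<Gamma> \<phi>"
| v_red:
  "\<lbrakk> valid \<Sigma> \<Gamma> \<phi>; red\<^sup>*\<^sup>* \<phi> \<psi> \<or> red\<^sup>*\<^sup>* \<psi> \<phi>; has_cty \<Sigma> \<Gamma> \<psi> (Tot (Univ i)) \<rbrakk> \<Longrightarrow> valid \<Sigma> \<Gamma> \<psi>"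
| v_allI:
  "\<lbrakk> has_cty \<Sigma> \<Gamma> t (Tot (Univ i)); valid \<Sigma> (t # \<Gamma>) \<phi> \<rbrakk> \<Longrightarrow> valid \<Sigma> \<Gamma> (Pi t (Tot \<phi>))"
| v_allE:
  "\<lbrakk> valid \<Sigma> \<Gamma> (Pi t (Tot \<phi>)); has_cty \<Sigma> \<Gamma> e (Tot t) \<rbrakk> \<Longrightarrow> valid \<Sigma> \<Gamma> (sub (inst e) \<phi>)"
| v_mp: "\<lbrakk> valid \<Sigma> \<Gamma> (arr \<phi> \<psi>); valid \<Sigma> \<Gamma> \<phi> \<rbrakk> \<Longrightarrow> valid \<Sigma> \<Gamma> \<psi>"
| v_conjI: "\<lbrakk> valid \<Sigma> \<Gamma> \<phi>; valid \<Sigma> \<Gamma> \<psi> \<rbrakk> \<Longrightarrow> valid \<Sigma> \<Gamma> (Prod \<phi> \<psi>)"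
| v_conjE1: "valid \<Sigma> \<Gamma> (Prod \<phi> \<psi>) \<Longrightarrow> valid \<Sigma> \<Gamma> \<phi>"
| v_conjE2: "valid \<Sigma> \<Gamma> (Prod \<phi> \<psi>) \<Longrightarrow> valid \<Sigma> \<Gamma> \<psi>"
| v_disjI1: "\<lbrakk> valid \<Sigma> \<Gamma> \<phi>; has_cty \<Sigma> \<Gamma> \<psi> (Tot (Univ i)) \<rbrakk> \<Longrightarrow> valid \<Sigma> \<Gamma> (Sum \<phi> \<psi>)"
| v_disjI2: "\<lbrakk> valid \<Sigma> \<Gamma> \<psi>; has_cty \<Sigma> \<Gamma> \<phi> (Tot (Univ i)) \<rbrakk> \<Longrightarrow> valid \<Sigma> \<Gamma> (Sum \<phi> \<psi>)"
| v_disjE: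
  "\<lbrakk> valid \<Sigma> \<Gamma> (Sum \<phi> \<psi>); valid \<Sigma> (\<phi> # \<Gamma>) (lift \<chi>); valid \<Sigma> (\<psi> # \<Gamma>) (lift \<chi>) \<rbrakk> \<Longrightarrow> valid \<Sigma> \<Gamma> \<chi>"
| v_botE: "\<lbrakk> valid \<Sigma> \<Gamma> Bot; has_cty \<Sigma> \<Gamma> \<phi> (Tot (Univ i)) \<rbrakk> \<Longrightarrow> valid \<Sigma> \<Gamma> \<phi>"
| v_classical: "valid \<Sigma> \<Gamma> (arr (arr \<phi> Bot) Bot) \<Longrightarrow> valid \<Sigma> \<Gamma> \<phi>"
| v_refl: "\<lbrakk> has_cty \<Sigma> \<Gamma> t (Tot (Univ i)); has_cty \<Sigma> \<Gamma> e (Tot t) \<rbrakk> \<Longrightarrow> valid \<Sigma> \<Gamma> (Eq t e e)"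
| v_subst:
  "\<lbrakk> valid \<Sigma> \<Gamma> (Eq t e1 e2); has_cty \<Sigma> (t # \<Gamma>) \<phi> (Tot (Univ i)); valid \<Sigma> \<Gamma> (sub (inst e1) \<phi>) \<rbrakk>
   \<Longrightarrow> valid \<Sigma> \<Gamma> (sub (inst e2) \<phi>)"
| v_funext:
  "\<lbrakk> has_cty \<Sigma> \<Gamma> f (Tot (Pi t (Tot t'))); has_cty \<Sigma> \<Gamma> g (Tot (Pi t (Tot t')));
     valid \<Sigma> \<Gamma> (Pi t (Tot (Eq t' (App (lift f) (Var 0)) (App (lift g) (Var 0))))) \<rbrakk>
   \<Longrightarrow> valid \<Sigma> \<Gamma> (Eq (Pi t (Tot t')) f g)"


section \<open>The star translation\<close>

text \<open>
  The translation of a context \<open>\<Delta> | \<Gamma>\<close> binds the variables of \<open>\<Delta>\<close> first. Hence a type translated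
  below \<open>k\<close> term variables refers to the \<open>j\<close>-th type variable by the index \<open>k + j\<close>.
\<close>

primrec star_ty :: "nat \<Rightarrow> 'b ty \<Rightarrow> ('b, 'k) tm" where
  "star_ty k (TyVar j) = Var (k + j)"
| "star_ty k (TyBase b) = Base b"
| "star_ty k (TyArr \<epsilon> H H') =
     arr (star_ty k H) (case \<epsilon> of Eff_n \<Rightarrow> star_ty k H' | Eff_tau \<Rightarrow> wp_ty (star_ty k H'))"
| "star_ty k (TySum T U) = Sum (star_ty k T) (star_ty k U)"
| "star_ty k (TyProd T U) = Prod (star_ty k T) (star_ty k U)"

text \<open>
  In \<open>star k D\<close>, \<open>k\<close> is the length of the context of the derivation \<open>D\<close>; a variable of that context
  keeps its index. The type annotation of a translated case expression is the star type of its
  branches, which is a type of weakest preconditions if the branches are effectful.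
\<close>

primrec star :: "nat \<Rightarrow> ('b, 'k) deriv \<Rightarrow> ('b, 'k) tm" where
  "star k (DVar i) = Var i"
| "star k (DConst \<kappa> Ds) = foldl App (Cst \<kappa>) (map (star k) Ds)"
| "star k (DLam H \<epsilon> H' D) = Lam (star_ty k H) (star (Suc k) D)"
| "star k (DApp H \<epsilon> H' D1 D2) = App (star k D1) (star k D2)"
| "star k (DPair H H' D1 D2) = Pair (star k D1) (star k D2)"
| "star k (DFst H H' D) = Fst (star k D)"
| "star k (DSnd H H' D) = Snd (star k D)"
| "star k (DInl A A' D) = Inl (star k D)"
| "star k (DInr A A' D) = Inr (star k D)"
| "star k (DCase A A' H \<epsilon> D D1 D2) =
     case_nd (case \<epsilon> of Eff_n \<Rightarrow> star_ty k H | Eff_tau \<Rightarrow> wp_ty (star_ty k H))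
       (star k D) (star (Suc k) D1) (star (Suc k) D2)"
| "star k (DReturn A D) = Lam (pred_ty (star_ty k A)) (App (Var 0) (lift (star k D)))"
| "star k (DBind A A' D1 D2) =
     Lam (pred_ty (star_ty k A'))
       (App (lift (star k D1))
         (Lam (star_ty (Suc k) A) (App (ren (up_ren Suc) (star (Suc k) D2)) (Var 1))))"


section \<open>Elaboration\<close>

text \<open>
  \<open>F_ty k C wp\<close> is \<open>F\<^sub>C wp\<close> below \<open>k\<close> term variables, and \<open>G_cty k \<epsilon> H wp\<close> is the computation type
  \<open>G\<^sup>\<epsilon>\<^sub>H(wp)\<close>. Only arguments \<open>C\<close> with \<open>is_C C\<close> are meaningful for \<open>F_ty\<close>.
\<close>

fun F_ty :: "nat \<Rightarrow> 'b ty \<Rightarrow> ('b, 'k) tm \<Rightarrow> ('b, 'k) tm"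
  and G_cty :: "nat \<Rightarrow> eff \<Rightarrow> 'b ty \<Rightarrow> ('b, 'k) tm \<Rightarrow> ('b, 'k) cty"
where
  "F_ty k (TyProd C C') wp = Prod (F_ty k C (Fst wp)) (F_ty k C' (Snd wp))"
| "F_ty k (TyArr \<epsilon> H H') wp =
     (if is_C H
      then Pi (star_ty k H)
             (Tot (Pi (F_ty (Suc k) H (Var 0))
                     (G_cty (Suc (Suc k)) \<epsilon> H' (App (lift (lift wp)) (Var 1)))))
      else Pi (star_ty k H) (G_cty (Suc k) \<epsilon> H' (App (lift wp) (Var 0))))"
| "F_ty k _ wp = undefined"
| "G_cty k Eff_n C wp = Tot (F_ty k C wp)"
| "G_cty k Eff_tau A wp = Pure (star_ty k A) wp"

text \<open>
  A binding \<open>y : C\<close> of \<open>\<Gamma>\<close> is elaborated to the two bindings \<open>y\<^sup>w : C*\<close>, \<open>y : F\<^sub>C y\<^sup>w\<close>, a binding \<open>x : A\<close>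
  to one. So \<open>elab_len \<Gamma>\<close> is the number of term variables of the elaborated context, \<open>elab_idx \<Gamma> i\<close>
  is the index in it of the \<open>i\<close>-th variable of \<open>\<Gamma>\<close>, and \<open>s_ren \<Gamma>\<close> is the substitution
  \<open>s\<^sub>\<Gamma>\<close> (a renaming from the star context of \<open>\<Gamma>\<close> to the elaborated one), which sends \<open>y : C\<close> to
  \<open>y\<^sup>w\<close> and fixes the variables \<open>x : A\<close> and the type variables up to the change of index.
\<close>

primrec elab_len :: "'b ty list \<Rightarrow> nat" where
  "elab_len [] = 0"
| "elab_len (H # \<Gamma>) = (if is_C H then 2 else 1) + elab_len \<Gamma>"

primrec elab_ctx :: "nat \<Rightarrow> 'b ty list \<Rightarrow> ('b, 'k) tm list" where
  "elab_ctx \<Delta> [] = replicate \<Delta> (Univ 0)"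
| "elab_ctx \<Delta> (H # \<Gamma>) =
     (if is_C H
      then F_ty (Suc (elab_len \<Gamma>)) H (Var 0) # star_ty (elab_len \<Gamma>) H # elab_ctx \<Delta> \<Gamma>
      else star_ty (elab_len \<Gamma>) H # elab_ctx \<Delta> \<Gamma>)"

primrec elab_idx :: "'b ty list \<Rightarrow> nat \<Rightarrow> nat" where
  "elab_idx [] i = i"
| "elab_idx (H # \<Gamma>) i =
     (case i of 0 \<Rightarrow> 0 | Suc j \<Rightarrow> (if is_C H then 2 else 1) + elab_idx \<Gamma> j)"

primrec s_ren :: "'b ty list \<Rightarrow> nat \<Rightarrow> nat" where
  "s_ren [] i = i"
| "s_ren (H # \<Gamma>) i =
     (case i of 0 \<Rightarrow> (if is_C H then 1 else 0)
      | Suc j \<Rightarrow> (if is_C H then 2 else 1) + s_ren \<Gamma> j)"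

text \<open>\<open>star_s \<Gamma> D\<close> is \<open>e* s\<^sub>\<Gamma>\<close> for a derivation \<open>D\<close> of \<open>e\<close> in \<open>\<Gamma>\<close>.\<close>

definition star_s :: "'b ty list \<Rightarrow> ('b, 'k) deriv \<Rightarrow> ('b, 'k) tm" where
  "star_s \<Gamma> D = ren (s_ren \<Gamma>) (star (length \<Gamma>) D)"

text \<open>
  In the dependent case expression, the translated branches are weakened (\<open>up_ren Suc\<close>) by the
  variable \<open>z\<close>, which is bound outside of the branch variable.
\<close>

primrec elab :: "'b ty list \<Rightarrow> ('b, 'k) deriv \<Rightarrow> ('b, 'k) tm" where
  "elab \<Gamma> (DVar i) = Var (elab_idx \<Gamma> i)"
| "elab \<Gamma> (DConst \<kappa> Ds) = foldl App (Cst \<kappa>) (map (elab \<Gamma>) Ds)"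
| "elab \<Gamma> (DLam H \<epsilon> H' D) =
     (if is_C H
      then Lam (star_ty (elab_len \<Gamma>) H)
             (Lam (F_ty (Suc (elab_len \<Gamma>)) H (Var 0)) (elab (H # \<Gamma>) D))
      else Lam (star_ty (elab_len \<Gamma>) H) (elab (H # \<Gamma>) D))"
| "elab \<Gamma> (DApp H \<epsilon> H' D1 D2) =
     (if is_C H
      then App (App (elab \<Gamma> D1) (star_s \<Gamma> D2)) (elab \<Gamma> D2)
      else App (elab \<Gamma> D1) (elab \<Gamma> D2))"
| "elab \<Gamma> (DPair H H' D1 D2) = Pair (elab \<Gamma> D1) (elab \<Gamma> D2)"
| "elab \<Gamma> (DFst H H' D) = Fst (elab \<Gamma> D)"
| "elab \<Gamma> (DSnd H H' D) = Snd (elab \<Gamma> D)"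
| "elab \<Gamma> (DInl A A' D) = Inl (elab \<Gamma> D)"
| "elab \<Gamma> (DInr A A' D) = Inr (elab \<Gamma> D)"
| "elab \<Gamma> (DCase A A' H \<epsilon> D D1 D2) =
     (if is_C H
      then Case (F_ty (Suc (elab_len \<Gamma>)) H
                  (case_nd (star_ty (Suc (elab_len \<Gamma>)) H) (Var 0)
                    (ren (up_ren Suc) (star_s (A # \<Gamma>) D1))
                    (ren (up_ren Suc) (star_s (A' # \<Gamma>) D2))))
             (elab \<Gamma> D) (elab (A # \<Gamma>) D1) (elab (A' # \<Gamma>) D2)
      else case_nd (star_ty (elab_len \<Gamma>) H)
             (elab \<Gamma> D) (elab (A # \<Gamma>) D1) (elab (A' # \<Gamma>) D2))"
| "elab \<Gamma> (DReturn A D) = PReturn (star_ty (elab_len \<Gamma>) A) (elab \<Gamma> D)"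
| "elab \<Gamma> (DBind A A' D1 D2) =
     PBind (star_ty (elab_len \<Gamma>) A) (star_ty (elab_len \<Gamma>) A')
       (star_s \<Gamma> D1) (elab \<Gamma> D1)
       (Lam (star_ty (elab_len \<Gamma>) A) (star_s (A # \<Gamma>) D2)) (elab (A # \<Gamma>) D2)"

end

theory Submission
  imports Defs
begin

text \<open>
  The proof is by induction on derivations. On derivations of \<open>A ! n\<close> the elaboration and the star
  translation coincide, so only the cases \<open>C ! n\<close> and \<open>A ! \<tau>\<close> remain. In each of them the target
  typing rule yields the wanted type except that the index \<open>wp\<close> differs from \<open>e\<^sup>\<star> s\<close> by one
  beta, projection or case reduction. Such a step is absorbed by subsumption: \<open>F\<^sub>C\<close> is compatible
  with reduction, and convertible weakest preconditions imply each other. Subsumption asks for the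
  well-formedness of the new type, which follows from the typing of the star translation, transported
  from the star context to the elaborated context by a renaming.
\<close>

section \<open>Renaming and substitution\<close>

text \<open>The mismatched indices have a common origin. At an arrow \<open>F_ty\<close> applies its
  index to a bound variable, at a product it projects from it, and the dependent case and bind rules
  evaluate an index at \<open>Inl x\<close>, \<open>Inr x\<close> or \<open>x\<close>; the induction
  hypotheses speak of the star translations of the subterms instead. Applications, projections and
  effectful case expressions yield the right index directly. Since subtyping and validity accept a
  reduction in either direction, an index may be expanded into a redex as well as contracted. Typing
  derivations are moved only along renamings: weakening and s_\<Gamma> both are renamings. The
  substitutions in the conclusions of the application and case rules act on types alone and are
  computed syntactically, because \<open>F_ty\<close> commutes with them and star types mention only
  type variables.\<close>

lemma up_ren_simps [simp]: "up_ren r 0 = 0" "up_ren r (Suc i) = Suc (r i)"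
  by (simp_all add: up_ren_def)

lemma up_sub_simps [simp]: "up_sub s 0 = Var 0" "up_sub s (Suc i) = lift (s i)"
  by (simp_all add: up_sub_def)

lemma inst_simps [simp]: "inst e 0 = e" "inst e (Suc i) = Var i"
  by (simp_all add: inst_def)

lemma inst_under_simps [simp]: "inst_under f 0 = f (Var 0)" "inst_under f (Suc i) = Var (Suc i)"
  by (simp_all add: inst_under_def)

text \<open>Splitting an index into zero and successor lets the computation rules of
  \<open>up_ren\<close>, \<open>up_sub\<close> and \<open>inst\<close> decide the identities between
  substitutions below.\<close>

lemma fun_eq_natI: "f 0 = g 0 \<Longrightarrow> (\<And>i. f (Suc i) = g (Suc i)) \<Longrightarrow> f = g" for f g :: "nat \<Rightarrow> 'a"
  by (rule ext) (metis not0_implies_Suc)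

lemma up_ren_comp: "up_ren (r \<circ> r') = up_ren r \<circ> up_ren r'"
  by (rule fun_eq_natI) simp_all

lemma up_sub_comp_ren: "up_sub (s \<circ> r) = up_sub s \<circ> up_ren r"
  by (rule fun_eq_natI) simp_all

lemma
  fixes t :: "('b, 'k) tm" and c :: "('b, 'k) cty"
  shows ren_comp: "ren r (ren r' t) = ren (r \<circ> r') t"
  and ren_c_comp: "ren_c r (ren_c r' c) = ren_c (r \<circ> r') c"
  by (induction t and c arbitrary: r r' and r r') (simp_all add: up_ren_comp)

lemma sub_ren: "sub s (ren r t) = sub (s \<circ> r) t"
  and sub_c_ren_c: "sub_c s (ren_c r c) = sub_c (s \<circ> r) c"
  by (induction t and c arbitrary: r s and r s) (simp_all add: up_sub_comp_ren)

lemma ren_lift [simp]: "ren (up_ren r) (lift t) = lift (ren r t)"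
proof -
  have "up_ren r \<circ> Suc = Suc \<circ> r"
    by auto
  then show ?thesis
    by (simp add: ren_comp)
qed

lemma up_sub_comp_lift: "up_sub (ren r \<circ> s) = ren (up_ren r) \<circ> up_sub s"
  by (rule fun_eq_natI) simp_all

lemma ren_sub: "ren r (sub s t) = sub (ren r \<circ> s) t"
  and ren_c_sub_c: "ren_c r (sub_c s c) = sub_c (ren r \<circ> s) c"
  by (induction t and c arbitrary: r s and r s) (simp_all add: up_sub_comp_lift)

lemma sub_lift [simp]: "sub (up_sub s) (lift t) = lift (sub s t)"
proof -
  have "up_sub s \<circ> Suc = lift \<circ> s"
    by auto
  then show ?thesis
    by (simp add: sub_ren ren_sub)
qed

lemma up_sub_Var: "up_sub (Var \<circ> r) = Var \<circ> up_ren r"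
  by (rule fun_eq_natI) simp_all

lemma
  fixes t :: "('b, 'k) tm" and c :: "('b, 'k) cty"
  shows sub_Var_ren: "sub (Var \<circ> r) t = ren r t"
  and sub_c_Var_ren_c: "sub_c (Var \<circ> r) c = ren_c r c"
  by (induction t and c arbitrary: r and r) (simp_all add: up_sub_Var)

lemma up_ren_id: "up_ren (\<lambda>i. i) = (\<lambda>i. i)"
  by (rule fun_eq_natI) simp_all

lemma
  fixes t :: "('b, 'k) tm" and c :: "('b, 'k) cty"
  shows ren_id [simp]: "ren (\<lambda>i. i) t = t" and ren_c_id [simp]: "ren_c (\<lambda>i. i) c = c"
  by (induction t and c) (simp_all add: up_ren_id)

lemma sub_Var [simp]: "sub Var t = t"
  using sub_Var_ren[of "\<lambda>i. i" t] by (simp add: comp_def)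

lemma inst_lift [simp]: "sub (inst e) (lift t) = t"
proof -
  have "inst e \<circ> Suc = Var"
    by auto
  then show ?thesis
    by (simp add: sub_ren)
qed

text \<open>Beta and case contraction and the result of an application are all formed with
  \<open>inst\<close>, so their stability under renaming rests on this commutation.\<close>

lemma ren_inst: "ren r (sub (inst e) t) = sub (inst (ren r e)) (ren (up_ren r) t)"
  and ren_c_inst: "ren_c r (sub_c (inst e) c) = sub_c (inst (ren r e)) (ren_c (up_ren r) c)"
proof -
  have "ren r \<circ> inst e = inst (ren r e) \<circ> up_ren r"
    by (rule fun_eq_natI) simp_all
  then show "ren r (sub (inst e) t) = sub (inst (ren r e)) (ren (up_ren r) t)"
    "ren_c r (sub_c (inst e) c) = sub_c (inst (ren r e)) (ren_c (up_ren r) c)"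
    by (simp_all add: sub_ren ren_sub sub_c_ren_c ren_c_sub_c)
qed

text \<open>\<open>inst_under\<close> leaves a variable in the place of the one it replaces, hence
  \<open>up_ren r\<close> on both sides. The assumption is naturality of \<open>f\<close>, which
  holds for \<open>Inl\<close> and \<open>Inr\<close>.\<close>

lemma ren_inst_under:
  assumes "\<And>e. ren (up_ren r) (f e) = f (ren (up_ren r) e)"
  shows "ren (up_ren r) (sub (inst_under f) t) = sub (inst_under f) (ren (up_ren r) t)"
proof -
  have "ren (up_ren r) \<circ> inst_under f = inst_under f \<circ> up_ren r"
    by (rule fun_eq_natI) (simp_all add: assms)
  then show ?thesis
    by (simp add: sub_ren ren_sub)
qed

text \<open>Computes the contraction of \<open>(\<lambda>x. t) x\<close>: weakening the abstraction
  inserts a variable beneath its bound one, and the argument is that inserted variable.\<close>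

lemma inst_Var_under: "sub (inst (Var 0)) (ren (up_ren Suc) t) = t" for t :: "('b, 'k) tm"
proof -
  have "inst (Var 0) \<circ> up_ren Suc = (Var :: nat \<Rightarrow> ('b, 'k) tm)"
    by (rule fun_eq_natI) simp_all
  then show ?thesis
    by (simp add: sub_ren)
qed

lemma ren_defined_tys [simp]:
  "ren r (arr t t') = arr (ren r t) (ren r t')"
  "ren r (pred_ty t) = pred_ty (ren r t)"
  "ren r (wp_ty t) = wp_ty (ren r t)"
  "ren r (case_nd t e e1 e2) = case_nd (ren r t) (ren r e) (ren (up_ren r) e1) (ren (up_ren r) e2)"
  by (simp_all add: arr_def pred_ty_def wp_ty_def case_nd_def)

lemma sub_defined_tys [simp]:
  "sub s (arr t t') = arr (sub s t) (sub s t')"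
  "sub s (pred_ty t) = pred_ty (sub s t)"
  "sub s (wp_ty t) = wp_ty (sub s t)"
  "sub s (case_nd t e e1 e2) = case_nd (sub s t) (sub s e) (sub (up_sub s) e1) (sub (up_sub s) e2)"
  by (simp_all add: arr_def pred_ty_def wp_ty_def case_nd_def)

lemma ren_foldr_arr: "ren r (foldr arr (map Base bs) (Base b)) = foldr arr (map Base bs) (Base b)"
  by (induction bs) simp_all

section \<open>Stability of reduction under renaming\<close>

lemma
  fixes t t' :: "('b, 'k) tm" and c c' :: "('b, 'k) cty"
  shows red_ren: "red t t' \<Longrightarrow> red (ren r t) (ren r t')"
  and red_c_ren_c: "red_c c c' \<Longrightarrow> red_c (ren_c r c) (ren_c r c')"
  by (induction arbitrary: r and r rule: red_red_c.inducts)
    (auto simp: ren_inst intro: red_red_c.intros)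

lemma reds_ren: "red\<^sup>*\<^sup>* t t' \<Longrightarrow> red\<^sup>*\<^sup>* (ren r t) (ren r t')"
  by (induction rule: rtranclp_induct) (auto intro: red_ren rtranclp.rtrancl_into_rtrancl)

section \<open>Stability of the target judgments under renaming\<close>

text \<open>
  Extending a renaming below a binder does not presuppose that the bound type is well formed.
  This makes the induction go through without a regularity lemma: the well-formedness of the
  renamed context is recovered from the \<open>ctx_ok\<close> premises at the leaves of the derivation.
\<close>

inductive renames ::
  "('k \<Rightarrow> 'b list \<times> 'b) \<Rightarrow> (nat \<Rightarrow> nat) \<Rightarrow> ('b, 'k) tm list \<Rightarrow> ('b, 'k) tm list \<Rightarrow> bool"
  for \<Sigma>
where
  renames_base:
  "\<lbrakk> ctx_ok \<Sigma> \<Gamma>';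
     \<And>i. i < length \<Gamma> \<Longrightarrow> r i < length \<Gamma>' \<and>
       ren (\<lambda>j. j + Suc (r i)) (\<Gamma>' ! r i) = ren (\<lambda>j. r (j + Suc i)) (\<Gamma> ! i) \<rbrakk>
   \<Longrightarrow> renames \<Sigma> r \<Gamma> \<Gamma>'"
| renames_up: "renames \<Sigma> r \<Gamma> \<Gamma>' \<Longrightarrow> renames \<Sigma> (up_ren r) (t # \<Gamma>) (ren r t # \<Gamma>')"

text \<open>The entry \<open>\<Gamma> ! i\<close> lives in the tail of the context, so both types
  are shifted into the full contexts before being compared. Below a binder, the equation for a
  successor index is the \<open>lift\<close> of the one for its predecessor.\<close>

lemma renames_index:
  "renames \<Sigma> r \<Gamma> \<Gamma>' \<Longrightarrow> i < length \<Gamma> \<Longrightarrow> r i < length \<Gamma>' \<and>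
     ren (\<lambda>j. j + Suc (r i)) (\<Gamma>' ! r i) = ren (\<lambda>j. r (j + Suc i)) (\<Gamma> ! i)"
proof (induction arbitrary: i rule: renames.induct)
  case (renames_base \<Gamma>' \<Gamma> r)
  then show ?case by blast
next
  case (renames_up r \<Gamma> \<Gamma>' t)
  show ?case
  proof (cases i)
    case 0
    then show ?thesis by (simp add: ren_comp comp_def)
  next
    case (Suc m)
    then have IH: "r m < length \<Gamma>'"
      "ren (\<lambda>j. j + Suc (r m)) (\<Gamma>' ! r m) = ren (\<lambda>j. r (j + Suc m)) (\<Gamma> ! m)"
      using renames_up.IH[of m] renames_up.prems by auto
    have "lift (ren (\<lambda>j. j + Suc (r m)) (\<Gamma>' ! r m)) = lift (ren (\<lambda>j. r (j + Suc m)) (\<Gamma> ! m))"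
      using IH(2) by simp
    then show ?thesis
      using IH(1) Suc by (simp add: ren_comp comp_def)
  qed
qed

lemma ctx_ok_renames: "ctx_ok \<Sigma> \<Gamma> \<Longrightarrow> renames \<Sigma> r \<Gamma> \<Gamma>' \<Longrightarrow> ctx_ok \<Sigma> \<Gamma>'"
  and has_cty_renames:
    "has_cty \<Sigma> \<Gamma> e c \<Longrightarrow> renames \<Sigma> r \<Gamma> \<Gamma>' \<Longrightarrow> has_cty \<Sigma> \<Gamma>' (ren r e) (ren_c r c)"
  and cty_ok_renames: "cty_ok \<Sigma> \<Gamma> c i \<Longrightarrow> renames \<Sigma> r \<Gamma> \<Gamma>' \<Longrightarrow> cty_ok \<Sigma> \<Gamma>' (ren_c r c) i"
  and sub_ty_renames:
    "sub_ty \<Sigma> \<Gamma> t t' \<Longrightarrow> renames \<Sigma> r \<Gamma> \<Gamma>' \<Longrightarrow> sub_ty \<Sigma> \<Gamma>' (ren r t) (ren r t')"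
  and sub_cty_renames:
    "sub_cty \<Sigma> \<Gamma> c c' \<Longrightarrow> renames \<Sigma> r \<Gamma> \<Gamma>' \<Longrightarrow> sub_cty \<Sigma> \<Gamma>' (ren_c r c) (ren_c r c')"
  and valid_renames: "valid \<Sigma> \<Gamma> \<phi> \<Longrightarrow> renames \<Sigma> r \<Gamma> \<Gamma>' \<Longrightarrow> valid \<Sigma> \<Gamma>' (ren r \<phi>)"
proof (induction arbitrary: r \<Gamma>' and r \<Gamma>' and r \<Gamma>' and r \<Gamma>' and r \<Gamma>' and r \<Gamma>'
    rule: ctx_ok_has_cty_cty_ok_sub_ty_sub_cty_valid.inducts)
  case ctx_nil
  then show ?case
    by cases (auto intro: ctx_nil)
next
  case (ctx_cons \<Gamma> t i)
  \<comment> \<open>A renaming out of \<open>t # \<Gamma>\<close> either carries the well-formedness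
    of its target or comes from \<open>renames_up\<close>; then the two induction hypotheses for the
    tail rebuild the target context.\<close>
  from ctx_cons.prems show ?case
  proof cases
    case renames_base
    then show ?thesis by simp
  next
    case (renames_up r' \<Gamma>'')
    then show ?thesis
      using ctx_cons.IH(2,4)[OF renames_up(3)]
      by (simp add: ctx_ok_has_cty_cty_ok_sub_ty_sub_cty_valid.ctx_cons)
  qed
next
  case (t_var \<Gamma> i)
  have idx: "r i < length \<Gamma>'"
    "ren (\<lambda>j. j + Suc (r i)) (\<Gamma>' ! r i) = ren (\<lambda>j. r (j + Suc i)) (\<Gamma> ! i)"
    using renames_index[OF t_var.prems \<open>i < length \<Gamma>\<close>] by auto
  have "has_cty \<Sigma> \<Gamma>' (Var (r i)) (Tot (ren (\<lambda>j. j + Suc (r i)) (\<Gamma>' ! r i)))"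
    using t_var idx(1) by (blast intro: ctx_ok_has_cty_cty_ok_sub_ty_sub_cty_valid.t_var)
  \<comment> \<open>The shifts must keep the literal form \<open>j + Suc _\<close> for
    \<open>idx(2)\<close> to rewrite them.\<close>
  then show ?case
    by (simp add: idx(2) ren_comp comp_def del: add_Suc_right)
next
  case (t_const \<Gamma> \<kappa> bs b)
  then show ?case
    by (auto simp: ren_foldr_arr intro: ctx_ok_has_cty_cty_ok_sub_ty_sub_cty_valid.t_const)
next
  case t_univ
  then show ?case
    by (fastforce simp: ren_inst ren_c_inst ren_inst_under
      intro: renames_up reds_ren ctx_ok_has_cty_cty_ok_sub_ty_sub_cty_valid.t_univ)
next
  case t_base
  then show ?case
    by (fastforce simp: ren_inst ren_c_inst ren_inst_under
      intro: renames_up reds_ren ctx_ok_has_cty_cty_ok_sub_ty_sub_cty_valid.t_base)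
next
  case t_Pi
  then show ?case
    by (fastforce simp: ren_inst ren_c_inst ren_inst_under
      intro: renames_up reds_ren ctx_ok_has_cty_cty_ok_sub_ty_sub_cty_valid.t_Pi)
next
  case t_lam
  then show ?case
    by (fastforce simp: ren_inst ren_c_inst ren_inst_under
      intro: renames_up reds_ren ctx_ok_has_cty_cty_ok_sub_ty_sub_cty_valid.t_lam)
next
  case t_app
  then show ?case
    by (fastforce simp: ren_inst ren_c_inst ren_inst_under
      intro: renames_up reds_ren ctx_ok_has_cty_cty_ok_sub_ty_sub_cty_valid.t_app)
next
  case t_Prod
  then show ?case
    by (fastforce simp: ren_inst ren_c_inst ren_inst_under
      intro: renames_up reds_ren ctx_ok_has_cty_cty_ok_sub_ty_sub_cty_valid.t_Prod)
next
  case t_pair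
  then show ?case
    by (fastforce simp: ren_inst ren_c_inst ren_inst_under
      intro: renames_up reds_ren ctx_ok_has_cty_cty_ok_sub_ty_sub_cty_valid.t_pair)
next
  case t_fst
  then show ?case
    by (fastforce simp: ren_inst ren_c_inst ren_inst_under
      intro: renames_up reds_ren ctx_ok_has_cty_cty_ok_sub_ty_sub_cty_valid.t_fst)
next
  case t_snd
  then show ?case
    by (fastforce simp: ren_inst ren_c_inst ren_inst_under
      intro: renames_up reds_ren ctx_ok_has_cty_cty_ok_sub_ty_sub_cty_valid.t_snd)
next
  case t_Sum
  then show ?case
    by (fastforce simp: ren_inst ren_c_inst ren_inst_under
      intro: renames_up reds_ren ctx_ok_has_cty_cty_ok_sub_ty_sub_cty_valid.t_Sum)
next
  case t_inl
  then show ?case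
    by (fastforce simp: ren_inst ren_c_inst ren_inst_under
      intro: renames_up reds_ren ctx_ok_has_cty_cty_ok_sub_ty_sub_cty_valid.t_inl)
next
  case t_inr
  then show ?case
    by (fastforce simp: ren_inst ren_c_inst ren_inst_under
      intro: renames_up reds_ren ctx_ok_has_cty_cty_ok_sub_ty_sub_cty_valid.t_inr)
next
  case t_case
  then show ?case
    by (fastforce simp: ren_inst ren_c_inst ren_inst_under
      intro: renames_up reds_ren ctx_ok_has_cty_cty_ok_sub_ty_sub_cty_valid.t_case)
next
  case t_case_pure
  then show ?case
    by (fastforce simp: ren_inst ren_c_inst ren_inst_under
      intro: renames_up reds_ren ctx_ok_has_cty_cty_ok_sub_ty_sub_cty_valid.t_case_pure)
next
  case t_return
  then show ?case
    by (fastforce simp: ren_inst ren_c_inst ren_inst_under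
      intro: renames_up reds_ren ctx_ok_has_cty_cty_ok_sub_ty_sub_cty_valid.t_return)
next
  case (t_bind \<Gamma> t1 t2 e1 w1 w2 e2)
  \<comment> \<open>The index in the conclusion nests lifts around \<open>w1\<close> and
    \<open>w2\<close>. It is stated with the renaming inside the lifts, the form that
    \<open>ren_lift\<close> produces.\<close>
  note up = renames_up[OF t_bind.prems, of t1]
  have "has_cty \<Sigma> \<Gamma>' (PBind (ren r t1) (ren r t2) (ren r w1) (ren r e1) (ren r w2) (ren (up_ren r) e2))
      (Pure (ren r t2) (Lam (pred_ty (ren r t2)) (App (lift (ren r w1)) (Lam (lift (ren r t1))
        (App (App (lift (lift (ren r w2))) (Var 0)) (Var 1))))))"
    using t_bind up by (intro ctx_ok_has_cty_cty_ok_sub_ty_sub_cty_valid.t_bind) force+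
  then show ?case
    by simp
next
  case t_Bot
  then show ?case
    by (fastforce simp: ren_inst ren_c_inst ren_inst_under
      intro: renames_up reds_ren ctx_ok_has_cty_cty_ok_sub_ty_sub_cty_valid.t_Bot)
next
  case t_Eq
  then show ?case
    by (fastforce simp: ren_inst ren_c_inst ren_inst_under
      intro: renames_up reds_ren ctx_ok_has_cty_cty_ok_sub_ty_sub_cty_valid.t_Eq)
next
  case t_sub
  then show ?case
    by (fastforce simp: ren_inst ren_c_inst ren_inst_under
      intro: renames_up reds_ren ctx_ok_has_cty_cty_ok_sub_ty_sub_cty_valid.t_sub)
next
  case c_Tot
  then show ?case
    by (fastforce simp: ren_inst ren_c_inst ren_inst_under
      intro: renames_up reds_ren ctx_ok_has_cty_cty_ok_sub_ty_sub_cty_valid.c_Tot)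
next
  case c_Pure
  then show ?case
    by (fastforce simp: ren_inst ren_c_inst ren_inst_under
      intro: renames_up reds_ren ctx_ok_has_cty_cty_ok_sub_ty_sub_cty_valid.c_Pure)
next
  case s_red
  then show ?case
    by (fastforce simp: ren_inst ren_c_inst ren_inst_under
      intro: renames_up reds_ren ctx_ok_has_cty_cty_ok_sub_ty_sub_cty_valid.s_red)
next
  case s_Pi
  then show ?case
    by (fastforce simp: ren_inst ren_c_inst ren_inst_under
      intro: renames_up reds_ren ctx_ok_has_cty_cty_ok_sub_ty_sub_cty_valid.s_Pi)
next
  case s_Tot
  then show ?case
    by (fastforce simp: ren_inst ren_c_inst ren_inst_under
      intro: renames_up reds_ren ctx_ok_has_cty_cty_ok_sub_ty_sub_cty_valid.s_Tot)
next
  case s_Pure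
  then show ?case
    by (fastforce simp: ren_inst ren_c_inst ren_inst_under
      intro: renames_up reds_ren ctx_ok_has_cty_cty_ok_sub_ty_sub_cty_valid.s_Pure)
next
  case v_inhabited
  then show ?case
    by (fastforce simp: ren_inst ren_c_inst ren_inst_under
      intro: renames_up reds_ren ctx_ok_has_cty_cty_ok_sub_ty_sub_cty_valid.v_inhabited)
next
  case v_red
  then show ?case
    by (fastforce simp: ren_inst ren_c_inst ren_inst_under
      intro: renames_up reds_ren ctx_ok_has_cty_cty_ok_sub_ty_sub_cty_valid.v_red)
next
  case v_allI
  then show ?case
    by (fastforce simp: ren_inst ren_c_inst ren_inst_under
      intro: renames_up reds_ren ctx_ok_has_cty_cty_ok_sub_ty_sub_cty_valid.v_allI)
next
  case v_allE
  then show ?case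
    by (fastforce simp: ren_inst ren_c_inst ren_inst_under
      intro: renames_up reds_ren ctx_ok_has_cty_cty_ok_sub_ty_sub_cty_valid.v_allE)
next
  case v_mp
  then show ?case
    by (fastforce simp: ren_inst ren_c_inst ren_inst_under
      intro: renames_up reds_ren ctx_ok_has_cty_cty_ok_sub_ty_sub_cty_valid.v_mp)
next
  case v_conjI
  then show ?case
    by (fastforce simp: ren_inst ren_c_inst ren_inst_under
      intro: renames_up reds_ren ctx_ok_has_cty_cty_ok_sub_ty_sub_cty_valid.v_conjI)
next
  case v_conjE1
  then show ?case
    by simp (blast intro: ctx_ok_has_cty_cty_ok_sub_ty_sub_cty_valid.v_conjE1)
next
  case v_conjE2
  then show ?case
    by simp (blast intro: ctx_ok_has_cty_cty_ok_sub_ty_sub_cty_valid.v_conjE2)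
next
  case v_disjI1
  then show ?case
    by (fastforce simp: ren_inst ren_c_inst ren_inst_under
      intro: renames_up reds_ren ctx_ok_has_cty_cty_ok_sub_ty_sub_cty_valid.v_disjI1)
next
  case v_disjI2
  then show ?case
    by (fastforce simp: ren_inst ren_c_inst ren_inst_under
      intro: renames_up reds_ren ctx_ok_has_cty_cty_ok_sub_ty_sub_cty_valid.v_disjI2)
next
  case v_disjE
  then show ?case
    by (fastforce simp: ren_inst ren_c_inst ren_inst_under
      intro: renames_up reds_ren ctx_ok_has_cty_cty_ok_sub_ty_sub_cty_valid.v_disjE)
next
  case v_botE
  then show ?case
    by (fastforce simp: ren_inst ren_c_inst ren_inst_under
      intro: renames_up reds_ren ctx_ok_has_cty_cty_ok_sub_ty_sub_cty_valid.v_botE)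
next
  case v_classical
  then show ?case
    by (fastforce simp: ren_inst ren_c_inst ren_inst_under
      intro: renames_up reds_ren ctx_ok_has_cty_cty_ok_sub_ty_sub_cty_valid.v_classical)
next
  case v_refl
  then show ?case
    by (fastforce simp: ren_inst ren_c_inst ren_inst_under
      intro: renames_up reds_ren ctx_ok_has_cty_cty_ok_sub_ty_sub_cty_valid.v_refl)
next
  case v_subst
  then show ?case
    by (fastforce simp: ren_inst ren_c_inst ren_inst_under
      intro: renames_up reds_ren ctx_ok_has_cty_cty_ok_sub_ty_sub_cty_valid.v_subst)
next
  case v_funext
  then show ?case
    by (fastforce simp: ren_inst ren_c_inst ren_inst_under
      intro: renames_up reds_ren ctx_ok_has_cty_cty_ok_sub_ty_sub_cty_valid.v_funext)
qed

section \<open>Rule names, well-formed contexts and weakening\<close>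

lemmas ctx_nil = ctx_ok_has_cty_cty_ok_sub_ty_sub_cty_valid.ctx_nil
  and ctx_cons = ctx_ok_has_cty_cty_ok_sub_ty_sub_cty_valid.ctx_cons
  and t_var = ctx_ok_has_cty_cty_ok_sub_ty_sub_cty_valid.t_var
  and t_univ = ctx_ok_has_cty_cty_ok_sub_ty_sub_cty_valid.t_univ
  and t_base = ctx_ok_has_cty_cty_ok_sub_ty_sub_cty_valid.t_base
  and t_const = ctx_ok_has_cty_cty_ok_sub_ty_sub_cty_valid.t_const
  and t_Pi = ctx_ok_has_cty_cty_ok_sub_ty_sub_cty_valid.t_Pi
  and t_lam = ctx_ok_has_cty_cty_ok_sub_ty_sub_cty_valid.t_lam
  and t_app = ctx_ok_has_cty_cty_ok_sub_ty_sub_cty_valid.t_app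
  and t_Prod = ctx_ok_has_cty_cty_ok_sub_ty_sub_cty_valid.t_Prod
  and t_pair = ctx_ok_has_cty_cty_ok_sub_ty_sub_cty_valid.t_pair
  and t_fst = ctx_ok_has_cty_cty_ok_sub_ty_sub_cty_valid.t_fst
  and t_snd = ctx_ok_has_cty_cty_ok_sub_ty_sub_cty_valid.t_snd
  and t_Sum = ctx_ok_has_cty_cty_ok_sub_ty_sub_cty_valid.t_Sum
  and t_inl = ctx_ok_has_cty_cty_ok_sub_ty_sub_cty_valid.t_inl
  and t_inr = ctx_ok_has_cty_cty_ok_sub_ty_sub_cty_valid.t_inr
  and t_case = ctx_ok_has_cty_cty_ok_sub_ty_sub_cty_valid.t_case
  and t_case_pure = ctx_ok_has_cty_cty_ok_sub_ty_sub_cty_valid.t_case_pure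
  and t_return = ctx_ok_has_cty_cty_ok_sub_ty_sub_cty_valid.t_return
  and t_bind = ctx_ok_has_cty_cty_ok_sub_ty_sub_cty_valid.t_bind
  and t_sub = ctx_ok_has_cty_cty_ok_sub_ty_sub_cty_valid.t_sub
  and c_Tot = ctx_ok_has_cty_cty_ok_sub_ty_sub_cty_valid.c_Tot
  and c_Pure = ctx_ok_has_cty_cty_ok_sub_ty_sub_cty_valid.c_Pure
  and s_red = ctx_ok_has_cty_cty_ok_sub_ty_sub_cty_valid.s_red
  and s_Tot = ctx_ok_has_cty_cty_ok_sub_ty_sub_cty_valid.s_Tot
  and s_Pure = ctx_ok_has_cty_cty_ok_sub_ty_sub_cty_valid.s_Pure
  and v_inhabited = ctx_ok_has_cty_cty_ok_sub_ty_sub_cty_valid.v_inhabited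
  and v_red = ctx_ok_has_cty_cty_ok_sub_ty_sub_cty_valid.v_red

text \<open>Every typing and validity rule has a premise from which the well-formedness of its
  context follows. The subtyping parts are \<open>True\<close> because \<open>s_red\<close> holds in
  an arbitrary context.\<close>

lemma "ctx_ok \<Sigma> \<Gamma> \<Longrightarrow> True"
  and has_cty_ctx_ok: "has_cty \<Sigma> \<Gamma> e c \<Longrightarrow> ctx_ok \<Sigma> \<Gamma>"
  and "cty_ok \<Sigma> \<Gamma> c i \<Longrightarrow> ctx_ok \<Sigma> \<Gamma>"
  and "sub_ty \<Sigma> \<Gamma> t t' \<Longrightarrow> True"
  and "sub_cty \<Sigma> \<Gamma> c c' \<Longrightarrow> True"
  and "valid \<Sigma> \<Gamma> \<phi> \<Longrightarrow> ctx_ok \<Sigma> \<Gamma>"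
  by (induction rule: ctx_ok_has_cty_cty_ok_sub_ty_sub_cty_valid.inducts) auto

text \<open>Adds a binding to the target only, where \<open>renames_up\<close> adds one on both
  sides. This gives weakening, and it handles the binding \<open>y : F\<^sub>C y\<^sup>w\<close>,
  which has no counterpart in the star context.\<close>

lemma renames_shift:
  assumes "renames \<Sigma> r \<Gamma> \<Gamma>'" and "ctx_ok \<Sigma> (t # \<Gamma>')"
  shows "renames \<Sigma> (Suc \<circ> r) \<Gamma> (t # \<Gamma>')"
proof (rule renames_base[OF assms(2)])
  fix i assume "i < length \<Gamma>"
  then have IH: "r i < length \<Gamma>'"
    "ren (\<lambda>j. j + Suc (r i)) (\<Gamma>' ! r i) = ren (\<lambda>j. r (j + Suc i)) (\<Gamma> ! i)"
    using renames_index[OF assms(1)] by auto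
  have "lift (ren (\<lambda>j. j + Suc (r i)) (\<Gamma>' ! r i)) = lift (ren (\<lambda>j. r (j + Suc i)) (\<Gamma> ! i))"
    using IH(2) by simp
  then show "(Suc \<circ> r) i < length (t # \<Gamma>') \<and>
      ren (\<lambda>j. j + Suc ((Suc \<circ> r) i)) ((t # \<Gamma>') ! (Suc \<circ> r) i) =
      ren (\<lambda>j. (Suc \<circ> r) (j + Suc i)) (\<Gamma> ! i)"
    using IH(1) by (simp add: ren_comp comp_def)
qed

lemma renames_refl: "ctx_ok \<Sigma> \<Gamma> \<Longrightarrow> renames \<Sigma> (\<lambda>i. i) \<Gamma> \<Gamma>"
  by (rule renames_base) auto

lemma renames_Suc:
  assumes "has_cty \<Sigma> \<Gamma> t (Tot (Univ i))"
  shows "renames \<Sigma> Suc \<Gamma> (t # \<Gamma>)"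
  using renames_shift[OF renames_refl ctx_cons[OF _ assms]] has_cty_ctx_ok[OF assms]
  by (simp add: comp_def)

lemma weakening:
  assumes "has_cty \<Sigma> \<Gamma> e (Tot u)" and "has_cty \<Sigma> \<Gamma> t (Tot (Univ i))"
  shows "has_cty \<Sigma> (t # \<Gamma>) (lift e) (Tot (lift u))"
  using has_cty_renames[OF assms(1) renames_Suc[OF assms(2)]] by simp

lemma weakening_ty:
  "has_cty \<Sigma> \<Gamma> u (Tot (Univ j)) \<Longrightarrow> has_cty \<Sigma> \<Gamma> t (Tot (Univ i)) \<Longrightarrow>
   has_cty \<Sigma> (t # \<Gamma>) (lift u) (Tot (Univ j))"
  using weakening by fastforce

text \<open>The new binding goes beneath the most recent one. This is the weakening of a
  continuation by the postcondition p, and of case branches by the scrutinee z.\<close>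

lemma weakening_under:
  assumes "has_cty \<Sigma> (u # \<Gamma>) e (Tot u')" and "has_cty \<Sigma> \<Gamma> t (Tot (Univ i))"
  shows "has_cty \<Sigma> (lift u # t # \<Gamma>) (ren (up_ren Suc) e) (Tot (ren (up_ren Suc) u'))"
  using has_cty_renames[OF assms(1) renames_up[OF renames_Suc[OF assms(2)]]] by simp

section \<open>Derived typing rules of the target\<close>

lemma t_var0: "has_cty \<Sigma> \<Gamma> t (Tot (Univ i)) \<Longrightarrow> has_cty \<Sigma> (t # \<Gamma>) (Var 0) (Tot (lift t))"
  using t_var[of \<Sigma> "t # \<Gamma>" 0] ctx_cons has_cty_ctx_ok by fastforce

lemma t_var1:
  assumes "has_cty \<Sigma> \<Gamma> t (Tot (Univ i))" and "has_cty \<Sigma> (t # \<Gamma>) u (Tot (Univ j))"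
  shows "has_cty \<Sigma> (u # t # \<Gamma>) (Var (Suc 0)) (Tot (lift (lift t)))"
  using weakening[OF t_var0[OF assms(1)] assms(2)] by simp

lemma t_app_arr:
  "has_cty \<Sigma> \<Gamma> e1 (Tot (arr t t')) \<Longrightarrow> has_cty \<Sigma> \<Gamma> e2 (Tot t) \<Longrightarrow> has_cty \<Sigma> \<Gamma> (App e1 e2) (Tot t')"
  using t_app[of \<Sigma> \<Gamma> e1 t "Tot (lift t')" e2] by (simp add: arr_def)

lemma t_lam_arr:
  "has_cty \<Sigma> \<Gamma> t (Tot (Univ i)) \<Longrightarrow> has_cty \<Sigma> (t # \<Gamma>) e (Tot (lift t')) \<Longrightarrow>
   has_cty \<Sigma> \<Gamma> (Lam t e) (Tot (arr t t'))"
  unfolding arr_def by (rule t_lam)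

lemma t_arr:
  "has_cty \<Sigma> \<Gamma> t (Tot (Univ i)) \<Longrightarrow> has_cty \<Sigma> \<Gamma> t' (Tot (Univ j)) \<Longrightarrow>
   has_cty \<Sigma> \<Gamma> (arr t t') (Tot (Univ (max i j)))"
  unfolding arr_def using weakening[of \<Sigma> \<Gamma> t' "Univ j" t i] by (auto intro: t_Pi c_Tot)

lemma t_pred_ty:
  assumes "has_cty \<Sigma> \<Gamma> t (Tot (Univ 0))"
  shows "has_cty \<Sigma> \<Gamma> (pred_ty t) (Tot (Univ 1))"
  using t_arr[OF assms t_univ[OF has_cty_ctx_ok[OF assms]], of 0] by (simp add: pred_ty_def)

lemma t_wp_ty:
  assumes "has_cty \<Sigma> \<Gamma> t (Tot (Univ 0))"
  shows "has_cty \<Sigma> \<Gamma> (wp_ty t) (Tot (Univ 1))"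
  using t_arr[OF t_pred_ty[OF assms] t_univ[OF has_cty_ctx_ok[OF assms]], of 0]
  by (simp add: wp_ty_def)

lemma inst_under_lift [simp]: "sub (inst_under f) (lift t) = lift t" for t :: "('b, 'k) tm"
proof -
  have "inst_under f \<circ> Suc = (Var \<circ> Suc :: nat \<Rightarrow> ('b, 'k) tm)"
    by auto
  then show ?thesis
    by (simp add: sub_ren sub_Var_ren)
qed

text \<open>The motive is \<open>t\<close> weakened by the scrutinee, so all its instances are
  weakenings of \<open>t\<close>. The typings of \<open>t1\<close> and \<open>t2\<close> supply that
  \<open>Sum t1 t2\<close> may be added to the context.\<close>

lemma t_case_nd:
  assumes "has_cty \<Sigma> \<Gamma> e (Tot (Sum t1 t2))"
    and "has_cty \<Sigma> \<Gamma> t1 (Tot (Univ i1))" "has_cty \<Sigma> \<Gamma> t2 (Tot (Univ i2))"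
    and "has_cty \<Sigma> \<Gamma> t (Tot (Univ i))"
    and "has_cty \<Sigma> (t1 # \<Gamma>) e1 (Tot (lift t))" "has_cty \<Sigma> (t2 # \<Gamma>) e2 (Tot (lift t))"
  shows "has_cty \<Sigma> \<Gamma> (case_nd t e e1 e2) (Tot t)"
proof -
  have "has_cty \<Sigma> (Sum t1 t2 # \<Gamma>) (lift t) (Tot (Univ i))"
    using weakening[OF assms(4) t_Sum[OF assms(2,3)]] by simp
  then have "has_cty \<Sigma> \<Gamma> (Case (lift t) e e1 e2) (Tot (sub (inst e) (lift t)))"
    using assms by (intro t_case) auto
  then show ?thesis
    by (simp add: case_nd_def)
qed

lemma t_wp_return:
  assumes "has_cty \<Sigma> \<Gamma> t (Tot (Univ 0))" and "has_cty \<Sigma> \<Gamma> e (Tot t)"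
  shows "has_cty \<Sigma> \<Gamma> (Lam (pred_ty t) (App (Var 0) (lift e))) (Tot (wp_ty t))"
proof -
  note p = t_pred_ty[OF assms(1)]
  have "has_cty \<Sigma> (pred_ty t # \<Gamma>) (Var 0) (Tot (arr (lift t) (Univ 0)))"
    using t_var0[OF p] by (simp add: pred_ty_def)
  then have "has_cty \<Sigma> (pred_ty t # \<Gamma>) (App (Var 0) (lift e)) (Tot (lift (Univ 0)))"
    using t_app_arr[OF _ weakening[OF assms(2) p]] by simp
  then show ?thesis
    unfolding wp_ty_def by (rule t_lam_arr[OF p])
qed

text \<open>\<open>w2\<close> lives below x only; \<open>ren (up_ren Suc)\<close> inserts p between
  x and \<Gamma>, and \<open>Var 1\<close> is that p.\<close>

lemma t_wp_bind:
  assumes "has_cty \<Sigma> \<Gamma> t1 (Tot (Univ 0))" and "has_cty \<Sigma> \<Gamma> t2 (Tot (Univ 0))"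
    and "has_cty \<Sigma> \<Gamma> w1 (Tot (wp_ty t1))"
    and "has_cty \<Sigma> (t1 # \<Gamma>) w2 (Tot (wp_ty (lift t2)))"
  shows "has_cty \<Sigma> \<Gamma>
    (Lam (pred_ty t2) (App (lift w1) (Lam (lift t1) (App (ren (up_ren Suc) w2) (Var 1)))))
    (Tot (wp_ty t2))"
proof -
  note p = t_pred_ty[OF assms(2)]
  have t1: "has_cty \<Sigma> (pred_ty t2 # \<Gamma>) (lift t1) (Tot (Univ 0))"
    using weakening[OF assms(1) p] by simp
  have "has_cty \<Sigma> (lift t1 # pred_ty t2 # \<Gamma>) (ren (up_ren Suc) w2)
      (Tot (arr (lift (lift (pred_ty t2))) (Univ 0)))"
    using weakening_under[OF assms(4) p] by (simp add: wp_ty_def)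
  then have "has_cty \<Sigma> (lift t1 # pred_ty t2 # \<Gamma>) (App (ren (up_ren Suc) w2) (Var 1))
      (Tot (lift (Univ 0)))"
    using t_app_arr[OF _ t_var1[OF p t1]] by simp
  then have "has_cty \<Sigma> (pred_ty t2 # \<Gamma>) (Lam (lift t1) (App (ren (up_ren Suc) w2) (Var 1)))
      (Tot (pred_ty (lift t1)))"
    unfolding pred_ty_def[of "lift t1"] by (rule t_lam_arr[OF t1])
  moreover have "has_cty \<Sigma> (pred_ty t2 # \<Gamma>) (lift w1) (Tot (arr (pred_ty (lift t1)) (Univ 0)))"
    using weakening[OF assms(3) p] by (simp add: wp_ty_def)
  ultimately have "has_cty \<Sigma> (pred_ty t2 # \<Gamma>)
      (App (lift w1) (Lam (lift t1) (App (ren (up_ren Suc) w2) (Var 1)))) (Tot (lift (Univ 0)))"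
    using t_app_arr by fastforce
  then show ?thesis
    unfolding wp_ty_def by (rule t_lam_arr[OF p])
qed

lemma arr_mono_red: "red t' t'' \<Longrightarrow> red (arr t t') (arr t t'')"
  unfolding arr_def by (intro red_Pi2 red_Tot red_ren)

text \<open>
  Convertible weakest preconditions are interchangeable: the required implication is convertible
  to \<open>\<forall>p. w p \<Rightarrow> w p\<close>, which is inhabited by the identity.
\<close>

lemma pure_conv:
  fixes w w' :: "('b, 'k) tm"
  assumes e: "has_cty \<Sigma> \<Gamma> e (Pure t w)" and t: "has_cty \<Sigma> \<Gamma> t (Tot (Univ 0))"
    and w: "has_cty \<Sigma> \<Gamma> w (Tot (wp_ty t))" and w': "has_cty \<Sigma> \<Gamma> w' (Tot (wp_ty t))"
    and red: "red w w' \<or> red w' w"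
  shows "has_cty \<Sigma> \<Gamma> e (Pure t w')"
proof -
  define X where "X u = App (lift u) (Var 0)" for u :: "('b, 'k) tm"
  note p = t_pred_ty[OF t]
  have X: "has_cty \<Sigma> (pred_ty t # \<Gamma>) (X u) (Tot (Univ 0))"
    if "has_cty \<Sigma> \<Gamma> u (Tot (wp_ty t))" for u
    unfolding X_def using t_app_arr[OF _ t_var0[OF p]] weakening[OF that p] by (simp add: wp_ty_def)
  have "has_cty \<Sigma> (pred_ty t # \<Gamma>) (Lam (X w') (Var 0)) (Tot (arr (X w') (X w')))"
    using t_lam_arr[OF X[OF w'] t_var0[OF X[OF w']]] .
  then have id: "valid \<Sigma> \<Gamma> (Pi (pred_ty t) (Tot (arr (X w') (X w'))))"
    using t_lam[OF p] v_inhabited by blast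
  have "red (X w) (X w') \<or> red (X w') (X w)"
    unfolding X_def using red by (auto intro: red_App1 red_ren)
  \<comment> \<open>Only the conclusion of the implication is changed; \<open>v_red\<close> accepts
    the step in whichever direction it goes.\<close>
  then have "red (Pi (pred_ty t) (Tot (arr (X w') (X w)))) (Pi (pred_ty t) (Tot (arr (X w') (X w')))) \<or>
    red (Pi (pred_ty t) (Tot (arr (X w') (X w')))) (Pi (pred_ty t) (Tot (arr (X w') (X w))))"
    by (auto intro: red_Pi2 red_Tot arr_mono_red)
  \<comment> \<open>The unevaluated level is the one assembled by \<open>t_Pi\<close> and
    \<open>t_arr\<close>: predicates live in \<open>Univ 1\<close>, the formulas \<open>X w\<close>
    in \<open>Univ 0\<close>.\<close>
  moreover have "has_cty \<Sigma> \<Gamma> (Pi (pred_ty t) (Tot (arr (X w') (X w)))) (Tot (Univ (max 1 (max 0 0))))"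
    by (intro t_Pi p c_Tot t_arr X w w')
  ultimately have "valid \<Sigma> \<Gamma> (Pi (pred_ty t) (Tot (arr (X w') (X w))))"
    using v_red[OF id] by blast
  then have "sub_cty \<Sigma> \<Gamma> (Pure t w) (Pure t w')"
    unfolding X_def by (intro s_Pure s_red) auto
  then show ?thesis
    using t_sub[OF e _ c_Pure[OF t w']] by blast
qed

section \<open>The types \<open>H\<^sup>\<star>\<close> and \<open>F\<^sub>C wp\<close>\<close>

lemma is_A_not_C: "is_A T \<Longrightarrow> \<not> is_C T"
  by (induction T) (auto split: eff.splits)

text \<open>The star type of a whole result \<open>H ! \<epsilon>\<close>, so that one typing
  statement covers pure and effectful terms.\<close>

definition res_ty :: "nat \<Rightarrow> eff \<Rightarrow> 'b ty \<Rightarrow> ('b, 'k) tm" where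
  "res_ty k \<epsilon> H = (case \<epsilon> of Eff_n \<Rightarrow> star_ty k H | Eff_tau \<Rightarrow> wp_ty (star_ty k H))"

lemma res_ty_simps [simp]:
  "res_ty k Eff_n H = star_ty k H" "res_ty k Eff_tau H = wp_ty (star_ty k H)"
  by (simp_all add: res_ty_def)

lemma star_ty_TyArr: "star_ty k (TyArr \<epsilon> H H') = arr (star_ty k H) (res_ty k \<epsilon> H')"
  by (simp add: res_ty_def)

declare star_ty.simps(3) [simp del] star_ty_TyArr [simp]

text \<open>Star types contain only type variables. Hence \<open>s\<close> is constrained on the
  indices from \<open>k\<close> on and may do anything to the term variables.\<close>

lemma star_ty_sub: "(\<And>j. s (k + j) = Var (k' + j)) \<Longrightarrow> sub s (star_ty k T) = star_ty k' T"
  by (induction T) (auto simp: res_ty_def split: eff.splits)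

lemma star_ty_ren: "(\<And>j. r (k + j) = k' + j) \<Longrightarrow> ren r (star_ty k T) = star_ty k' T"
  using star_ty_sub[of "Var \<circ> r" k k' T] by (simp add: sub_Var_ren)

lemma lift_star_ty [simp]: "lift (star_ty k T) = star_ty (Suc k) T"
  by (rule star_ty_ren) simp

lemma res_ty_ren: "(\<And>j. r (k + j) = k' + j) \<Longrightarrow> ren r (res_ty k \<epsilon> T) = res_ty k' \<epsilon> T"
  by (cases \<epsilon>) (simp_all add: star_ty_ren)

lemma lift_res_ty [simp]: "lift (res_ty k \<epsilon> T) = res_ty (Suc k) \<epsilon> T"
  by (rule res_ty_ren) simp

text \<open>The results \<open>C ! n\<close> and \<open>A ! \<tau>\<close> of the two claims. They
  are also exactly the codomains that place an arrow with well-formed domain in the category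
  C.\<close>

definition is_res :: "eff \<Rightarrow> 'b ty \<Rightarrow> bool" where
  "is_res \<epsilon> H \<longleftrightarrow> (case \<epsilon> of Eff_n \<Rightarrow> is_C H | Eff_tau \<Rightarrow> is_A H)"

lemma is_res_simps [simp]: "is_res Eff_n H = is_C H" "is_res Eff_tau H = is_A H"
  by (simp_all add: is_res_def)

lemma is_C_TyArr: "is_C (TyArr \<epsilon> H H') \<longleftrightarrow> (is_A H \<or> is_C H) \<and> is_res \<epsilon> H'"
  by (simp add: is_res_def)

declare is_C.simps(3) [simp del] is_C_TyArr [simp]

text \<open>Apart from its own binders, the only term variables of \<open>F_ty k C wp\<close> are
  those of \<open>wp\<close>. The condition on C avoids the \<open>undefined\<close> clause, about
  which substitution says nothing.\<close>

lemma
  fixes s :: "nat \<Rightarrow> ('b, 'k) tm"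
  shows F_ty_sub: "is_C C \<Longrightarrow> (\<And>j. s (k + j) = Var (k' + j)) \<Longrightarrow> sub s (F_ty k C wp) = F_ty k' C (sub s wp)"
  and G_cty_sub: "is_res \<epsilon> H \<Longrightarrow> (\<And>j. s (k + j) = Var (k' + j)) \<Longrightarrow>
    sub_c s (G_cty k \<epsilon> H wp) = G_cty k' \<epsilon> H (sub s wp)"
  by (induction k C wp and k \<epsilon> H wp arbitrary: s k' and s k' rule: F_ty_G_cty.induct)
    (auto simp: star_ty_sub)

lemma F_ty_ren:
  "is_C C \<Longrightarrow> (\<And>j. r (k + j) = k' + j) \<Longrightarrow> ren r (F_ty k C wp) = F_ty k' C (ren r wp)"
  for wp :: "('b, 'k) tm"
  using F_ty_sub[where s = "Var \<circ> r :: nat \<Rightarrow> ('b, 'k) tm" and C = C and k = k and k' = k'] by (simp add: sub_Var_ren)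

lemma G_cty_inst: "is_res \<epsilon> H \<Longrightarrow> sub_c (inst e) (G_cty (Suc k) \<epsilon> H wp) = G_cty k \<epsilon> H (sub (inst e) wp)"
  by (rule G_cty_sub) simp_all

section \<open>Behaviour of \<open>F_ty\<close> under reduction, and universes of the translated
  types\<close>

lemma reds_Prod: "red\<^sup>*\<^sup>* t1 t1' \<Longrightarrow> red\<^sup>*\<^sup>* t2 t2' \<Longrightarrow> red\<^sup>*\<^sup>* (Prod t1 t2) (Prod t1' t2')"
proof -
  assume "red\<^sup>*\<^sup>* t1 t1'" then have "red\<^sup>*\<^sup>* (Prod t1 t2) (Prod t1' t2)"
    by (induction rule: rtranclp_induct) (auto intro: red_Prod1 rtranclp.rtrancl_into_rtrancl)
  also assume "red\<^sup>*\<^sup>* t2 t2'" then have "red\<^sup>*\<^sup>* (Prod t1' t2) (Prod t1' t2')"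
    by (induction rule: rtranclp_induct) (auto intro: red_Prod2 rtranclp.rtrancl_into_rtrancl)
  finally show ?thesis .
qed

lemma reds_Pi: "red_c\<^sup>*\<^sup>* c c' \<Longrightarrow> red\<^sup>*\<^sup>* (Pi t c) (Pi t c')"
  by (induction rule: rtranclp_induct) (auto intro: red_Pi2 rtranclp.rtrancl_into_rtrancl)

lemma reds_Tot: "red\<^sup>*\<^sup>* t t' \<Longrightarrow> red_c\<^sup>*\<^sup>* (Tot t) (Tot t')"
  by (induction rule: rtranclp_induct) (auto intro: red_Tot rtranclp.rtrancl_into_rtrancl)

text \<open>One step of the index becomes several because a product uses its index twice.\<close>

lemma
  fixes wp wp' :: "('b, 'k) tm"
  shows F_ty_red: "is_C C \<Longrightarrow> red wp wp' \<Longrightarrow> red\<^sup>*\<^sup>* (F_ty k C wp) (F_ty k C wp')"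
  and G_cty_red: "is_res \<epsilon> H \<Longrightarrow> red wp wp' \<Longrightarrow> red_c\<^sup>*\<^sup>* (G_cty k \<epsilon> H wp) (G_cty k \<epsilon> H wp')"
proof (induction k C wp and k \<epsilon> H wp arbitrary: wp' and wp' rule: F_ty_G_cty.induct)
  case (1 k C C' wp)
  then show ?case
    by (auto intro!: reds_Prod "1.IH" red_Fst red_Snd)
next
  case (2 k \<epsilon> H H' wp)
  then show ?case
    by (auto intro!: reds_Pi reds_Tot "2.IH" red_App1 red_ren simp del: One_nat_def)
qed (auto intro!: reds_Tot red_Pure2)

text \<open>Records only where the type variables sit, beyond \<open>k\<close> term variables. Star
  contexts, elaborated contexts and their extensions by arbitrary bindings are all
  instances.\<close>

definition ty_ctx :: "('k \<Rightarrow> 'b list \<times> 'b) \<Rightarrow> nat \<Rightarrow> nat \<Rightarrow> ('b, 'k) tm list \<Rightarrow> bool" where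
  "ty_ctx \<Sigma> \<Delta> k \<Gamma> \<longleftrightarrow> ctx_ok \<Sigma> \<Gamma> \<and> (\<forall>j<\<Delta>. k + j < length \<Gamma> \<and> \<Gamma> ! (k + j) = Univ 0)"

lemma ty_ctx_ok: "ty_ctx \<Sigma> \<Delta> k \<Gamma> \<Longrightarrow> ctx_ok \<Sigma> \<Gamma>"
  by (simp add: ty_ctx_def)

lemma ty_ctx_cons:
  "ty_ctx \<Sigma> \<Delta> k \<Gamma> \<Longrightarrow> has_cty \<Sigma> \<Gamma> t (Tot (Univ i)) \<Longrightarrow> ty_ctx \<Sigma> \<Delta> (Suc k) (t # \<Gamma>)"
  by (auto simp: ty_ctx_def intro: ctx_cons)

lemma ty_ctx_replicate: "ty_ctx \<Sigma> \<Delta> 0 (replicate \<Delta> (Univ 0))"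
proof -
  have "ctx_ok \<Sigma> (replicate \<Delta> (Univ 0))"
    by (induction \<Delta>) (auto intro: ctx_nil ctx_cons t_univ)
  then show ?thesis
    by (simp add: ty_ctx_def)
qed

text \<open>An A type has no \<tau>-arrow, so no predicate type raises the universe. Level 0 is what
  \<open>Pure\<close> demands of its result type.\<close>

lemma t_star_ty_A:
  "ty_ctx \<Sigma> \<Delta> k \<Gamma> \<Longrightarrow> wf_A \<Delta> T \<Longrightarrow> has_cty \<Sigma> \<Gamma> (star_ty k T) (Tot (Univ 0))"
proof (induction T)
  case (TyVar j)
  then have "has_cty \<Sigma> \<Gamma> (Var (k + j)) (Tot (ren (\<lambda>l. l + Suc (k + j)) (\<Gamma> ! (k + j))))"
    by (intro t_var) (auto simp: ty_ctx_def wf_A_def)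
  then show ?case
    using TyVar by (simp add: ty_ctx_def wf_A_def)
next
  case (TyArr \<epsilon> T U)
  then show ?case
    using t_arr[of \<Sigma> \<Gamma> "star_ty k T" 0 "star_ty k U" 0] by (simp add: wf_A_def)
next
  case (TySum T U)
  then show ?case
    using t_Sum[of \<Sigma> \<Gamma> "star_ty k T" 0 "star_ty k U" 0] by (simp add: wf_A_def)
next
  case (TyProd T U)
  then show ?case
    using t_Prod[of \<Sigma> \<Gamma> "star_ty k T" 0 "star_ty k U" 0] by (simp add: wf_A_def)
qed (auto intro: t_base simp: ty_ctx_ok)

text \<open>The universe is existential because a \<tau>-arrow contributes \<open>wp_ty\<close>,
  which is typed in \<open>Univ 1\<close>.\<close>

lemma t_star_ty: "ty_ctx \<Sigma> \<Delta> k \<Gamma> \<Longrightarrow> wf_H \<Delta> T \<Longrightarrow> \<exists>i. has_cty \<Sigma> \<Gamma> (star_ty k T) (Tot (Univ i))"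
proof (induction T)
  case (TyArr \<epsilon> T U)
  then have "\<exists>i. has_cty \<Sigma> \<Gamma> (star_ty k T) (Tot (Univ i))"
    by (auto simp: wf_H_def)
  moreover have "\<exists>i. has_cty \<Sigma> \<Gamma> (res_ty k \<epsilon> U) (Tot (Univ i))"
    using TyArr t_wp_ty[OF t_star_ty_A[of \<Sigma> \<Delta> k \<Gamma> U]]
    by (cases \<epsilon>) (auto simp: wf_H_def wf_A_def)
  ultimately show ?case
    using t_arr by fastforce
next
  case (TySum T U)
  then show ?case
    using t_star_ty_A[of \<Sigma> \<Delta> k \<Gamma> "TySum T U"] by (auto simp: wf_H_def wf_A_def)
next
  case (TyProd T U)
  then have "\<exists>i. has_cty \<Sigma> \<Gamma> (star_ty k T) (Tot (Univ i))" "\<exists>i. has_cty \<Sigma> \<Gamma> (star_ty k U) (Tot (Univ i))"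
    by (auto simp: wf_H_def)
  then show ?case
    using t_Prod by fastforce
next
  case (TyVar j)
  then show ?case
    using t_star_ty_A[of \<Sigma> \<Delta> k \<Gamma> "TyVar j"] by (auto simp: wf_H_def wf_A_def)
next
  case (TyBase b)
  then show ?case
    using t_star_ty_A[of \<Sigma> \<Delta> k \<Gamma> "TyBase b"] by (auto simp: wf_H_def wf_A_def)
qed

lemma t_res_ty:
  "ty_ctx \<Sigma> \<Delta> k \<Gamma> \<Longrightarrow> wf_result \<Delta> T \<epsilon> \<Longrightarrow> \<exists>i. has_cty \<Sigma> \<Gamma> (res_ty k \<epsilon> T) (Tot (Univ i))"
  by (cases \<epsilon>) (auto simp: wf_result_def dest: t_star_ty t_wp_ty[OF t_star_ty_A])

lemma
  fixes wp :: "('b, 'k) tm"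
  shows F_ty_wf: "is_C C \<Longrightarrow> ty_ctx \<Sigma> \<Delta> k \<Gamma> \<Longrightarrow> tvars C \<subseteq> {..<\<Delta>} \<Longrightarrow> has_cty \<Sigma> \<Gamma> wp (Tot (star_ty k C)) \<Longrightarrow>
    \<exists>i. has_cty \<Sigma> \<Gamma> (F_ty k C wp) (Tot (Univ i))"
  and G_cty_wf: "is_res \<epsilon> H \<Longrightarrow> ty_ctx \<Sigma> \<Delta> k \<Gamma> \<Longrightarrow> tvars H \<subseteq> {..<\<Delta>} \<Longrightarrow>
    has_cty \<Sigma> \<Gamma> wp (Tot (res_ty k \<epsilon> H)) \<Longrightarrow> \<exists>i. cty_ok \<Sigma> \<Gamma> (G_cty k \<epsilon> H wp) i"
proof (induction k C wp and k \<epsilon> H wp arbitrary: \<Gamma> and \<Gamma> rule: F_ty_G_cty.induct)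
  case (1 k C C' wp)
  then show ?case
    by (fastforce intro: t_fst t_snd t_Prod)
next
  case (2 k \<epsilon> H H' wp)
  have wp: "has_cty \<Sigma> \<Gamma> wp (Tot (arr (star_ty k H) (res_ty k \<epsilon> H')))"
    using 2 by simp
  obtain i where i: "has_cty \<Sigma> \<Gamma> (star_ty k H) (Tot (Univ i))"
    using t_star_ty[of \<Sigma> \<Delta> k \<Gamma> H] 2 by (auto simp: wf_H_def)
  let ?\<Gamma> = "star_ty k H # \<Gamma>"
  have c1: "ty_ctx \<Sigma> \<Delta> (Suc k) ?\<Gamma>"
    using ty_ctx_cons 2 i by blast
  have v0: "has_cty \<Sigma> ?\<Gamma> (Var 0) (Tot (star_ty (Suc k) H))"
    using t_var0[OF i] by simp
  have wp1: "has_cty \<Sigma> ?\<Gamma> (lift wp) (Tot (arr (star_ty (Suc k) H) (res_ty (Suc k) \<epsilon> H')))"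
    using weakening[OF wp i] by simp
  show ?case
  proof (cases "is_C H")
    case True
    obtain j where j: "has_cty \<Sigma> ?\<Gamma> (F_ty (Suc k) H (Var 0)) (Tot (Univ j))"
      using "2.IH"(1)[OF True True c1 _ v0] 2 by auto
    \<comment> \<open>Below both bindings of a C domain, \<open>Var 1\<close> is the index variable,
      and \<open>wp\<close> is applied to it.\<close>
    let ?\<Gamma>' = "F_ty (Suc k) H (Var 0) # ?\<Gamma>"
    have c2: "ty_ctx \<Sigma> \<Delta> (Suc (Suc k)) ?\<Gamma>'"
      using ty_ctx_cons c1 j by blast
    have "has_cty \<Sigma> ?\<Gamma>' (App (lift (lift wp)) (Var 1)) (Tot (res_ty (Suc (Suc k)) \<epsilon> H'))"
      using t_app_arr[OF _ weakening[OF v0 j]] weakening[OF wp1 j] by simp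
    then obtain l where "cty_ok \<Sigma> ?\<Gamma>' (G_cty (Suc (Suc k)) \<epsilon> H' (App (lift (lift wp)) (Var 1))) l"
      using "2.IH"(2)[OF True _ c2] 2 by auto
    then show ?thesis
      using True t_Pi[OF i c_Tot[OF t_Pi[OF j]]] by auto
  next
    case False
    have "has_cty \<Sigma> ?\<Gamma> (App (lift wp) (Var 0)) (Tot (res_ty (Suc k) \<epsilon> H'))"
      using t_app_arr[OF wp1 v0] .
    then obtain l where "cty_ok \<Sigma> ?\<Gamma> (G_cty (Suc k) \<epsilon> H' (App (lift wp) (Var 0))) l"
      using "2.IH"(3)[OF False _ c1] 2 by auto
    then show ?thesis
      using False t_Pi[OF i] by auto
  qed
next
  case (4 k C wp)
  then show ?case
    by (fastforce intro: c_Tot)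
next
  case (5 k A wp)
  then show ?case
    using c_Pure[OF t_star_ty_A] by (fastforce simp: wf_A_def)
qed auto

text \<open>Pure results are converted by subtyping along reduction, effectful ones by
  \<open>pure_conv\<close>. The typing of \<open>w'\<close> makes the new type well formed; that of
  \<open>w\<close> makes the implication in the \<open>Pure\<close> case a formula.\<close>

lemma G_cty_conv:
  assumes e: "has_cty \<Sigma> \<Gamma> e (G_cty k \<epsilon> H w)" and H: "is_res \<epsilon> H" "tvars H \<subseteq> {..<\<Delta>}"
    and ctx: "ty_ctx \<Sigma> \<Delta> k \<Gamma>"
    and w: "has_cty \<Sigma> \<Gamma> w (Tot (res_ty k \<epsilon> H))" and w': "has_cty \<Sigma> \<Gamma> w' (Tot (res_ty k \<epsilon> H))"
    and red: "red w w' \<or> red w' w"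
  shows "has_cty \<Sigma> \<Gamma> e (G_cty k \<epsilon> H w')"
proof (cases \<epsilon>)
  case Eff_n
  then have "sub_cty \<Sigma> \<Gamma> (G_cty k \<epsilon> H w) (G_cty k \<epsilon> H w')"
    using red H F_ty_red[of H] by (auto intro!: s_Tot s_red)
  then show ?thesis
    using t_sub[OF e] G_cty_wf[OF H(1) ctx H(2) w'] by blast
next
  case Eff_tau
  then show ?thesis
    using assms pure_conv[OF _ t_star_ty_A[OF ctx] _ _ red] by (simp add: wf_A_def)
qed

section \<open>Typing of the star translation\<close>

lemma dm_derives_wf_ctx: "dm_derives \<Sigma> D \<Delta> \<Gamma> e H \<epsilon> \<Longrightarrow> wf_ctx \<Delta> \<Gamma>"
  by (induction rule: dm_derives.induct) (auto simp: wf_ctx_def)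

lemma wf_H_cases: "wf_H \<Delta> T \<Longrightarrow> is_A T \<or> is_C T"
  by (simp add: wf_H_def)

lemma wf_H_TyArr: "wf_H \<Delta> (TyArr \<epsilon> H H') \<Longrightarrow> wf_H \<Delta> H \<and> wf_result \<Delta> H' \<epsilon>"
  by (cases \<epsilon>) (auto simp: wf_H_def wf_A_def wf_result_def)

primrec star_ctx :: "nat \<Rightarrow> 'b ty list \<Rightarrow> ('b, 'k) tm list" where
  "star_ctx \<Delta> [] = replicate \<Delta> (Univ 0)"
| "star_ctx \<Delta> (H # \<Gamma>) = star_ty (length \<Gamma>) H # star_ctx \<Delta> \<Gamma>"

lemma length_star_ctx: "length (star_ctx \<Delta> \<Gamma>) = length \<Gamma> + \<Delta>"
  by (induction \<Gamma>) auto

lemma ty_ctx_star_ctx: "wf_ctx \<Delta> \<Gamma> \<Longrightarrow> ty_ctx \<Sigma> \<Delta> (length \<Gamma>) (star_ctx \<Delta> \<Gamma>)"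
proof (induction \<Gamma>)
  case Nil
  then show ?case
    by (simp add: ty_ctx_replicate)
next
  case (Cons H \<Gamma>)
  then have "ty_ctx \<Sigma> \<Delta> (length \<Gamma>) (star_ctx \<Delta> \<Gamma>)" and "wf_H \<Delta> H"
    by (auto simp: wf_ctx_def)
  then show ?case
    using t_star_ty ty_ctx_cons by fastforce
qed

lemma t_star_var:
  fixes \<Sigma> :: "'k \<Rightarrow> 'b list \<times> 'b"
  assumes "wf_ctx \<Delta> \<Gamma>" and "i < length \<Gamma>"
  shows "has_cty \<Sigma> (star_ctx \<Delta> \<Gamma>) (Var i) (Tot (star_ty (length \<Gamma>) (\<Gamma> ! i)))"
proof -
  have "ren (\<lambda>j. j + Suc i) (star_ctx \<Delta> \<Gamma> ! i :: ('b, 'k) tm) = star_ty (length \<Gamma>) (\<Gamma> ! i)"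
    using assms(2)
  proof (induction \<Gamma> arbitrary: i)
    case (Cons H \<Gamma>)
    show ?case
    proof (cases i)
      case 0
      then show ?thesis by (simp add: star_ty_ren)
    next
      case (Suc m)
      then have "lift (ren (\<lambda>j. j + Suc m) (star_ctx \<Delta> \<Gamma> ! m :: ('b, 'k) tm)) = star_ty (Suc (length \<Gamma>)) (\<Gamma> ! m)"
        using Cons by simp
      then show ?thesis
        using Suc by (simp add: ren_comp comp_def)
    qed
  qed simp
  then show ?thesis
    using t_var[of \<Sigma> "star_ctx \<Delta> \<Gamma>" i] assms ty_ctx_ok[OF ty_ctx_star_ctx[OF assms(1), of \<Sigma>]]
    by (simp add: length_star_ctx)
qed

text \<open>The head \<open>f\<close> is generalised because \<open>foldl\<close> applies it to the
  first argument innermost.\<close>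

lemma t_const_app:
  assumes "has_cty \<Sigma> \<Gamma> f (Tot (foldr arr (map Base bs) (Base b)))" and "length ts = length bs"
    and "\<And>i. i < length bs \<Longrightarrow> has_cty \<Sigma> \<Gamma> (ts ! i) (Tot (Base (bs ! i)))"
  shows "has_cty \<Sigma> \<Gamma> (foldl App f ts) (Tot (Base b))"
  using assms
proof (induction bs arbitrary: f ts)
  case (Cons a bs)
  then obtain u us where ts: "ts = u # us"
    by (cases ts) auto
  have "has_cty \<Sigma> \<Gamma> (App f u) (Tot (foldr arr (map Base bs) (Base b)))"
    using Cons.prems(1) Cons.prems(3)[of 0] by (auto simp: ts intro: t_app_arr)
  moreover have "has_cty \<Sigma> \<Gamma> (us ! i) (Tot (Base (bs ! i)))" if "i < length bs" for i
    using Cons.prems(3)[of "Suc i"] that by (simp add: ts)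
  ultimately show ?case
    using Cons.IH[of "App f u" us] Cons.prems(2) by (simp add: ts)
qed simp

text \<open>All results are included, also \<open>A ! n\<close>, since such subterms occur in
  derivations of the other two kinds.\<close>

lemma t_star:
  "dm_derives \<Sigma> D \<Delta> \<Gamma> e H \<epsilon> \<Longrightarrow>
   has_cty \<Sigma> (star_ctx \<Delta> \<Gamma>) (star (length \<Gamma>) D) (Tot (res_ty (length \<Gamma>) \<epsilon> H))"
proof (induction rule: dm_derives.induct)
  case (dm_var \<Delta> \<Gamma> i)
  then show ?case
    by (simp add: t_star_var)
next
  case (dm_const \<Delta> \<Gamma> \<kappa> bs b es Ds)
  then show ?case
    using t_const[OF ty_ctx_ok[OF ty_ctx_star_ctx, of _ _ \<Sigma>]] by (auto intro!: t_const_app)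
next
  case (dm_lam \<Delta> \<epsilon> H H' D \<Gamma> e)
  then have "wf_ctx \<Delta> \<Gamma>"
    using dm_derives_wf_ctx by (fastforce simp: wf_ctx_def)
  then obtain i where "has_cty \<Sigma> (star_ctx \<Delta> \<Gamma>) (star_ty (length \<Gamma>) H) (Tot (Univ i))"
    using t_star_ty ty_ctx_star_ctx dm_lam.hyps(1) wf_H_TyArr by blast
  then show ?case
    using dm_lam.IH by (auto intro: t_lam_arr)
next
  case (dm_app \<Delta> \<epsilon> H H' D1 \<Gamma> f D2 e)
  then show ?case
    by (auto intro: t_app_arr)
next
  case (dm_inl \<Delta> A A' D \<Gamma> e)
  have "ty_ctx \<Sigma> \<Delta> (length \<Gamma>) (star_ctx \<Delta> \<Gamma>)"
    using ty_ctx_star_ctx dm_derives_wf_ctx dm_inl.hyps by blast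
  then show ?case
    using dm_inl t_star_ty_A by (fastforce intro: t_inl)
next
  case (dm_inr \<Delta> A A' D \<Gamma> e)
  have "ty_ctx \<Sigma> \<Delta> (length \<Gamma>) (star_ctx \<Delta> \<Gamma>)"
    using ty_ctx_star_ctx dm_derives_wf_ctx dm_inr.hyps by blast
  then show ?case
    using dm_inr t_star_ty_A by (fastforce intro: t_inr)
next
  case (dm_case \<Delta> A A' H \<epsilon> D \<Gamma> e D1 e1 D2 e2)
  have ctx: "ty_ctx \<Sigma> \<Delta> (length \<Gamma>) (star_ctx \<Delta> \<Gamma>)"
    using ty_ctx_star_ctx dm_derives_wf_ctx dm_case.hyps by blast
  obtain i where i: "has_cty \<Sigma> (star_ctx \<Delta> \<Gamma>) (res_ty (length \<Gamma>) \<epsilon> H) (Tot (Univ i))"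
    using t_res_ty[OF ctx] dm_case.hyps by blast
  have "has_cty \<Sigma> (star_ctx \<Delta> \<Gamma>)
      (case_nd (res_ty (length \<Gamma>) \<epsilon> H) (star (length \<Gamma>) D) (star (Suc (length \<Gamma>)) D1) (star (Suc (length \<Gamma>)) D2))
      (Tot (res_ty (length \<Gamma>) \<epsilon> H))"
    using dm_case.IH dm_case.hyps
    by (intro t_case_nd[OF _ t_star_ty_A[OF ctx] t_star_ty_A[OF ctx] i]) auto
  then show ?case
    by (simp add: res_ty_def)
next
  case (dm_return \<Delta> A D \<Gamma> e)
  have "ty_ctx \<Sigma> \<Delta> (length \<Gamma>) (star_ctx \<Delta> \<Gamma>)"
    using ty_ctx_star_ctx dm_derives_wf_ctx dm_return.hyps by blast
  then show ?case
    using dm_return t_wp_return[OF t_star_ty_A] by simp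
next
  case (dm_bind \<Delta> A A' D1 \<Gamma> e1 D2 e2)
  have ctx: "ty_ctx \<Sigma> \<Delta> (length \<Gamma>) (star_ctx \<Delta> \<Gamma>)"
    using ty_ctx_star_ctx dm_derives_wf_ctx dm_bind.hyps by blast
  then show ?case
    using t_wp_bind[OF t_star_ty_A[OF ctx] t_star_ty_A[OF ctx]] dm_bind by simp
qed (auto intro: t_pair t_fst t_snd)

section \<open>Elaborated contexts\<close>

lemma s_ren_Cons_A: "\<not> is_C H \<Longrightarrow> s_ren (H # \<Gamma>) = up_ren (s_ren \<Gamma>)"
  by (rule fun_eq_natI) simp_all

text \<open>The additional \<open>Suc\<close> steps over y, so that the bound variable is sent to
  its index variable y^w.\<close>

lemma s_ren_Cons_C: "is_C H \<Longrightarrow> s_ren (H # \<Gamma>) = Suc \<circ> up_ren (s_ren \<Gamma>)"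
  by (rule fun_eq_natI) simp_all

lemma s_ren_ty_var: "s_ren \<Gamma> (length \<Gamma> + j) = elab_len \<Gamma> + j"
  by (induction \<Gamma>) auto

lemma ren_s_star_ty [simp]: "ren (s_ren \<Gamma>) (star_ty (length \<Gamma>) T) = star_ty (elab_len \<Gamma>) T"
  by (rule star_ty_ren) (rule s_ren_ty_var)

lemma ren_s_res_ty [simp]: "ren (s_ren \<Gamma>) (res_ty (length \<Gamma>) \<epsilon> T) = res_ty (elab_len \<Gamma>) \<epsilon> T"
  by (rule res_ty_ren) (rule s_ren_ty_var)

lemma ren_up_s_star_ty [simp]:
  "ren (up_ren (s_ren \<Gamma>)) (star_ty (Suc (length \<Gamma>)) T) = star_ty (Suc (elab_len \<Gamma>)) T"
  using ren_lift[of "s_ren \<Gamma>" "star_ty (length \<Gamma>) T"] by simp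

text \<open>The two parts are proved together: carrying the renaming past y needs the context
  extended by \<open>F\<^sub>C y\<^sup>w\<close> to be well formed.\<close>

lemma elab_ctx_ok:
  "wf_ctx \<Delta> \<Gamma> \<Longrightarrow> ty_ctx \<Sigma> \<Delta> (elab_len \<Gamma>) (elab_ctx \<Delta> \<Gamma>) \<and>
    renames \<Sigma> (s_ren \<Gamma>) (star_ctx \<Delta> \<Gamma>) (elab_ctx \<Delta> \<Gamma>)"
proof (induction \<Gamma>)
  case Nil
  have "s_ren ([] :: 'a ty list) = (\<lambda>i. i)"
    by auto
  then show ?case
    using ty_ctx_replicate[of \<Sigma> \<Delta>] by (simp add: ty_ctx_ok renames_refl)
next
  case (Cons H \<Gamma>)
  then have ctx: "ty_ctx \<Sigma> \<Delta> (elab_len \<Gamma>) (elab_ctx \<Delta> \<Gamma>)"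
    and ren: "renames \<Sigma> (s_ren \<Gamma>) (star_ctx \<Delta> \<Gamma>) (elab_ctx \<Delta> \<Gamma>)"
    and H: "wf_H \<Delta> H"
    by (auto simp: wf_ctx_def)
  obtain i where i: "has_cty \<Sigma> (elab_ctx \<Delta> \<Gamma>) (star_ty (elab_len \<Gamma>) H) (Tot (Univ i))"
    using t_star_ty[OF ctx H] by blast
  note ctx' = ty_ctx_cons[OF ctx i]
  have ren': "renames \<Sigma> (up_ren (s_ren \<Gamma>)) (star_ctx \<Delta> (H # \<Gamma>)) (star_ty (elab_len \<Gamma>) H # elab_ctx \<Delta> \<Gamma>)"
    using renames_up[OF ren, of "star_ty (length \<Gamma>) H"] by simp
  show ?case
  proof (cases "is_C H")
    case True
    obtain j where j: "has_cty \<Sigma> (star_ty (elab_len \<Gamma>) H # elab_ctx \<Delta> \<Gamma>)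
        (F_ty (Suc (elab_len \<Gamma>)) H (Var 0)) (Tot (Univ j))"
      using F_ty_wf[OF True ctx'] t_var0[OF i] H by (auto simp: wf_H_def)
    note ctx'' = ty_ctx_cons[OF ctx' j]
    show ?thesis
      using True ctx'' renames_shift[OF ren' ty_ctx_ok[OF ctx'']] by (simp add: s_ren_Cons_C comp_def del: s_ren.simps)
  next
    case False
    then show ?thesis
      using ctx' ren' by (simp add: s_ren_Cons_A del: s_ren.simps)
  qed
qed

lemmas ty_ctx_elab = elab_ctx_ok[THEN conjunct1] and renames_elab = elab_ctx_ok[THEN conjunct2]

lemma t_star_s:
  "dm_derives \<Sigma> D \<Delta> \<Gamma> e H \<epsilon> \<Longrightarrow>
   has_cty \<Sigma> (elab_ctx \<Delta> \<Gamma>) (star_s \<Gamma> D) (Tot (res_ty (elab_len \<Gamma>) \<epsilon> H))"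
  using has_cty_renames[OF t_star renames_elab[OF dm_derives_wf_ctx]] by (simp add: star_s_def)

lemma ren_foldl_App: "ren r (foldl App f ts) = foldl App (ren r f) (map (ren r) ts)"
  by (induction ts arbitrary: f) simp_all

text \<open>Below an A binder s_\<Gamma> is just extended. Below a C binder the two sides differ by
  the skipped variable y, which the abstraction case of the main induction accounts for.\<close>

lemma star_s_body: "\<not> is_C H \<Longrightarrow> ren (up_ren (s_ren \<Gamma>)) (star (Suc (length \<Gamma>)) D) = star_s (H # \<Gamma>) D"
  by (simp add: star_s_def s_ren_Cons_A del: s_ren.simps)

lemma star_s_simps:
  "star_s \<Gamma> (DVar i) = Var (s_ren \<Gamma> i)"
  "star_s \<Gamma> (DConst \<kappa> Ds) = foldl App (Cst \<kappa>) (map (star_s \<Gamma>) Ds)"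
  "star_s \<Gamma> (DLam H \<epsilon> H' D) =
    Lam (star_ty (elab_len \<Gamma>) H) (ren (up_ren (s_ren \<Gamma>)) (star (Suc (length \<Gamma>)) D))"
  "star_s \<Gamma> (DApp H \<epsilon> H' D1 D2) = App (star_s \<Gamma> D1) (star_s \<Gamma> D2)"
  "star_s \<Gamma> (DPair H H' D1 D2) = Pair (star_s \<Gamma> D1) (star_s \<Gamma> D2)"
  "star_s \<Gamma> (DFst H H' D) = Fst (star_s \<Gamma> D)"
  "star_s \<Gamma> (DSnd H H' D) = Snd (star_s \<Gamma> D)"
  "star_s \<Gamma> (DInl A A' D) = Inl (star_s \<Gamma> D)"
  "star_s \<Gamma> (DInr A A' D) = Inr (star_s \<Gamma> D)"
  "star_s \<Gamma> (DReturn A D) =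
    Lam (pred_ty (star_ty (elab_len \<Gamma>) A)) (App (Var 0) (lift (star_s \<Gamma> D)))"
  by (auto simp: star_s_def[abs_def] ren_foldl_App comp_def)

lemma star_s_DCase:
  "\<not> is_C A \<Longrightarrow> \<not> is_C A' \<Longrightarrow> star_s \<Gamma> (DCase A A' H \<epsilon> D D1 D2) =
    case_nd (res_ty (elab_len \<Gamma>) \<epsilon> H) (star_s \<Gamma> D) (star_s (A # \<Gamma>) D1) (star_s (A' # \<Gamma>) D2)"
  using star_s_body[of A \<Gamma> D1] star_s_body[of A' \<Gamma> D2]
  by (simp add: star_s_def[of \<Gamma>] flip: res_ty_def)

lemma star_s_DBind:
  fixes D1 D2 :: "('b, 'k) deriv"
  assumes "\<not> is_C A"
  shows "star_s \<Gamma> (DBind A A' D1 D2) = Lam (pred_ty (star_ty (elab_len \<Gamma>) A'))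
    (App (lift (star_s \<Gamma> D1))
      (Lam (star_ty (Suc (elab_len \<Gamma>)) A) (App (ren (up_ren Suc) (star_s (A # \<Gamma>) D2)) (Var 1))))"
proof -
  \<comment> \<open>Inserting p beneath x commutes with s_\<Gamma>, which acts beneath both.\<close>
  have "up_ren (up_ren (s_ren \<Gamma>)) \<circ> up_ren Suc = up_ren Suc \<circ> up_ren (s_ren \<Gamma>)"
    by (rule fun_eq_natI) simp_all
  then have "ren (up_ren (up_ren (s_ren \<Gamma>))) (ren (up_ren Suc) t) =
      ren (up_ren Suc) (ren (up_ren (s_ren \<Gamma>)) t)" for t :: "('b, 'k) tm"
    by (simp add: ren_comp)
  then show ?thesis
    by (simp add: star_s_body[OF assms, symmetric] star_s_def[of \<Gamma>])
qed

section \<open>Elaboration\<close>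

text \<open>
  A derivation of \<open>e : A ! n\<close> has no subderivation of a type \<open>C\<close> or of effect \<open>\<tau>\<close>, so on it the
  elaboration and the star translation coincide. This identifies the index \<open>wp e\<close> of the type of
  an application with \<open>wp (e\<^sup>\<star> s)\<close>.
\<close>

lemma elab_eq_star_s:
  "dm_derives \<Sigma> D \<Delta> \<Gamma> e H \<epsilon> \<Longrightarrow> \<epsilon> = Eff_n \<Longrightarrow> is_A H \<Longrightarrow> elab \<Gamma> D = star_s \<Gamma> D"
proof (induction rule: dm_derives.induct)
  case (dm_var \<Delta> \<Gamma> i)
  have "elab_idx \<Gamma> i = s_ren \<Gamma> i"
    using dm_var.hyps(2) dm_var.prems
  proof (induction \<Gamma> arbitrary: i)
    case (Cons H \<Gamma>)
    then show ?case
      by (cases i) (auto simp: is_A_not_C)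
  qed simp
  then show ?case
    by (simp add: star_s_simps)
next
  case (dm_const \<Delta> \<Gamma> \<kappa> bs b es Ds)
  then have "map (elab \<Gamma>) Ds = map (star_s \<Gamma>) Ds"
    by (auto simp: list_eq_iff_nth_eq)
  then show ?case
    by (simp only: elab.simps star_s_simps)
next
  \<comment> \<open>Well-formed products are never mixed: one A component makes the whole product an
    A type, so the induction hypothesis applies.\<close>
  case (dm_fst \<Delta> H H' D \<Gamma> e)
  then show ?case
    by (auto simp: star_s_simps is_A_not_C dest: wf_H_cases)
next
  case (dm_snd \<Delta> H H' D \<Gamma> e)
  then show ?case
    by (auto simp: star_s_simps is_A_not_C dest: wf_H_cases)
next
  \<comment> \<open>An n-arrow into an A type cannot be a C type, so the function and its argument
    both have A types.\<close>
  case (dm_app \<Delta> \<epsilon> H H' D1 \<Gamma> f D2 e)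
  then show ?case
    by (auto simp: star_s_simps is_A_not_C dest: wf_H_cases)
qed (auto simp: star_s_simps star_s_body[symmetric] star_s_DCase is_A_not_C wf_A_def)

lemma t_elab_A:
  assumes "dm_derives \<Sigma> D \<Delta> \<Gamma> e A Eff_n" and "is_A A"
  shows "has_cty \<Sigma> (elab_ctx \<Delta> \<Gamma>) (elab \<Gamma> D) (Tot (star_ty (elab_len \<Gamma>) A))"
  using t_star_s[OF assms(1)] elab_eq_star_s[OF assms(1) refl assms(2)] by simp

lemma t_elab_var:
  assumes "wf_ctx \<Delta> \<Gamma>" and "i < length \<Gamma>" and "is_C (\<Gamma> ! i)"
  shows "has_cty \<Sigma> (elab_ctx \<Delta> \<Gamma>) (Var (elab_idx \<Gamma> i)) (Tot (F_ty (elab_len \<Gamma>) (\<Gamma> ! i) (Var (s_ren \<Gamma> i))))"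
  using assms
proof (induction \<Gamma> arbitrary: i)
  case (Cons H \<Gamma>)
  have wf: "wf_ctx \<Delta> \<Gamma>" "wf_H \<Delta> H"
    using Cons.prems by (auto simp: wf_ctx_def)
  note ctx = ty_ctx_elab[OF wf(1)]
  obtain j where j: "has_cty \<Sigma> (elab_ctx \<Delta> \<Gamma>) (star_ty (elab_len \<Gamma>) H) (Tot (Univ j))"
    using t_star_ty[OF ctx wf(2)] by blast
  note ctx' = ty_ctx_cons[OF ctx j]
  have lift_F: "lift (F_ty k C w) = F_ty (Suc k) C (lift w)" if "is_C C" for k C and w :: "('a, 'b) tm"
    by (rule F_ty_ren[OF that]) simp
  show ?case
  proof (cases i)
    case 0
    then have C: "is_C H"
      using Cons.prems by simp
    obtain l where l: "has_cty \<Sigma> (star_ty (elab_len \<Gamma>) H # elab_ctx \<Delta> \<Gamma>)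
        (F_ty (Suc (elab_len \<Gamma>)) H (Var 0)) (Tot (Univ l))"
      using F_ty_wf[OF C ctx'] t_var0[OF j] wf(2) by (auto simp: wf_H_def)
    \<comment> \<open>Lifting the type of y over y itself turns its index into \<open>Var 1\<close>,
      the value of \<open>s_ren\<close> at 0.\<close>
    show ?thesis
      using t_var0[OF l] 0 C by (simp add: lift_F)
  next
    case (Suc m)
    have IH: "has_cty \<Sigma> (elab_ctx \<Delta> \<Gamma>) (Var (elab_idx \<Gamma> m)) (Tot (F_ty (elab_len \<Gamma>) (\<Gamma> ! m) (Var (s_ren \<Gamma> m))))"
      using Cons Suc wf by simp
    have C: "is_C (\<Gamma> ! m)"
      using Cons.prems Suc by simp
    have IH': "has_cty \<Sigma> (star_ty (elab_len \<Gamma>) H # elab_ctx \<Delta> \<Gamma>) (Var (Suc (elab_idx \<Gamma> m)))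
        (Tot (F_ty (Suc (elab_len \<Gamma>)) (\<Gamma> ! m) (Var (Suc (s_ren \<Gamma> m)))))"
      using weakening[OF IH j] C by (simp add: lift_F)
    show ?thesis
    proof (cases "is_C H")
      case True
      obtain l where l: "has_cty \<Sigma> (star_ty (elab_len \<Gamma>) H # elab_ctx \<Delta> \<Gamma>)
          (F_ty (Suc (elab_len \<Gamma>)) H (Var 0)) (Tot (Univ l))"
        using F_ty_wf[OF True ctx'] t_var0[OF j] wf(2) by (auto simp: wf_H_def)
      show ?thesis
        using weakening[OF IH' l] Suc C True by (simp add: lift_F)
    next
      case False
      then show ?thesis
        using IH' Suc by simp
    qed
  qed
qed simp

text \<open>An abstraction over x : A and the continuation of a bind both need the index as a
  function applied to the bound variable; here the index of the body is expanded to that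
  form.\<close>

lemma G_cty_beta:
  assumes e: "has_cty \<Sigma> (t # \<Gamma>) e (G_cty (Suc k) \<epsilon> H w)" and H: "is_res \<epsilon> H" "tvars H \<subseteq> {..<\<Delta>}"
    and ctx: "ty_ctx \<Sigma> \<Delta> (Suc k) (t # \<Gamma>)"
    and t: "has_cty \<Sigma> \<Gamma> t (Tot (Univ i))"
    and w: "has_cty \<Sigma> (t # \<Gamma>) w (Tot (res_ty (Suc k) \<epsilon> H))"
  shows "has_cty \<Sigma> (t # \<Gamma>) e (G_cty (Suc k) \<epsilon> H (App (lift (Lam t w)) (Var 0)))"
proof (rule G_cty_conv[OF e H ctx w])
  have "has_cty \<Sigma> \<Gamma> (Lam t w) (Tot (arr t (res_ty k \<epsilon> H)))"
    using t_lam_arr[OF t] w by simp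
  then have "has_cty \<Sigma> (t # \<Gamma>) (lift (Lam t w)) (Tot (arr (lift t) (res_ty (Suc k) \<epsilon> H)))"
    using weakening[OF _ t] by fastforce
  then show "has_cty \<Sigma> (t # \<Gamma>) (App (lift (Lam t w)) (Var 0)) (Tot (res_ty (Suc k) \<epsilon> H))"
    using t_app_arr t_var0[OF t] by blast
  show "red w (App (lift (Lam t w)) (Var 0)) \<or> red (App (lift (Lam t w)) (Var 0)) w"
    using red_beta[of "lift t" "ren (up_ren Suc) w" "Var 0"] by (simp add: inst_Var_under)
qed

text \<open>\<open>is_res\<close> joins the two claims, which depend on each other: an abstraction
  of type C ! n may have an effectful body, and an effectful application has a function of type C !
  n.\<close>

lemma t_elab:
  fixes D :: "('b, 'k) deriv"
  shows "dm_derives \<Sigma> D \<Delta> \<Gamma> e H \<epsilon> \<Longrightarrow> is_res \<epsilon> H \<Longrightarrow>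
   has_cty \<Sigma> (elab_ctx \<Delta> \<Gamma>) (elab \<Gamma> D) (G_cty (elab_len \<Gamma>) \<epsilon> H (star_s \<Gamma> D))"
proof (induction rule: dm_derives.induct)
  case (dm_var \<Delta> \<Gamma> i)
  then show ?case
    by (simp add: t_elab_var star_s_simps)
next
  case (dm_lam \<Delta> \<epsilon> H H' D \<Gamma> e)
  let ?k = "elab_len \<Gamma>"
  let ?t = "star_ty ?k H" and ?w = "ren (up_ren (s_ren \<Gamma>)) (star (Suc (length \<Gamma>)) D)"
  have wf: "wf_ctx \<Delta> (H # \<Gamma>)"
    using dm_derives_wf_ctx dm_lam.hyps by blast
  then have ctx: "ty_ctx \<Sigma> \<Delta> ?k (elab_ctx \<Delta> \<Gamma>)" and H: "wf_H \<Delta> H"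
    using ty_ctx_elab by (auto simp: wf_ctx_def)
  obtain i where i: "has_cty \<Sigma> (elab_ctx \<Delta> \<Gamma>) ?t (Tot (Univ i))"
    using t_star_ty[OF ctx H] by blast
  have res: "is_res \<epsilon> H'" "tvars H' \<subseteq> {..<\<Delta>}"
    using dm_lam by (auto simp: wf_H_def)
  note IH = dm_lam.IH[OF res(1)]
  show ?case
  proof (cases "is_C H")
    case True
    let ?F = "F_ty (Suc ?k) H (Var 0)"
    obtain j where j: "has_cty \<Sigma> (?t # elab_ctx \<Delta> \<Gamma>) ?F (Tot (Univ j))"
      using F_ty_wf[OF True ty_ctx_cons[OF ctx i]] t_var0[OF i] H by (auto simp: wf_H_def)
    have ctx': "ty_ctx \<Sigma> \<Delta> (Suc (Suc ?k)) (?F # ?t # elab_ctx \<Delta> \<Gamma>)"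
      using ty_ctx_cons[OF ty_ctx_cons[OF ctx i] j] .
    have L: "has_cty \<Sigma> (elab_ctx \<Delta> \<Gamma>) (Lam ?t ?w) (Tot (arr ?t (res_ty ?k \<epsilon> H')))"
      using t_star_s[OF dm_derives.dm_lam[OF dm_lam.hyps(1,2)]] by (simp add: star_s_simps)
    let ?u = "App (lift (lift (Lam ?t ?w))) (Var 1)"
    have u: "has_cty \<Sigma> (?F # ?t # elab_ctx \<Delta> \<Gamma>) ?u (Tot (res_ty (Suc (Suc ?k)) \<epsilon> H'))"
      using t_app_arr[OF _ t_var1[OF i j]] weakening[OF weakening[OF L i] j] by simp
    \<comment> \<open>Weakening the body past y^w and y and putting y^w for its bound variable is
      exactly the substitution of the extended context, so \<open>?u\<close> contracts to the index
      of the induction hypothesis.\<close>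
    have "inst (Var 1) \<circ> up_ren Suc \<circ> up_ren Suc \<circ> up_ren (s_ren \<Gamma>) =
        (Var \<circ> s_ren (H # \<Gamma>) :: nat \<Rightarrow> ('b, 'k) tm)"
      using True by (intro fun_eq_natI) simp_all
    then have "sub (inst (Var 1)) (ren (up_ren Suc) (ren (up_ren Suc) ?w)) = star_s (H # \<Gamma>) D"
      by (simp add: sub_ren star_s_def sub_Var_ren del: s_ren.simps)
    then have red: "red ?u (star_s (H # \<Gamma>) D)"
      using red_beta[of "lift (lift ?t)" "ren (up_ren Suc) (ren (up_ren Suc) ?w)" "Var 1"] by simp
    have "has_cty \<Sigma> (?F # ?t # elab_ctx \<Delta> \<Gamma>) (elab (H # \<Gamma>) D) (G_cty (Suc (Suc ?k)) \<epsilon> H' ?u)"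
      using G_cty_conv[OF _ res ctx' _ u] IH t_star_s[OF dm_lam.hyps(2)] red True by simp
    then show ?thesis
      using t_lam[OF i t_lam[OF j]] True by (simp add: star_s_simps)
  next
    case False
    note ctx' = ty_ctx_cons[OF ctx i]
    have "has_cty \<Sigma> (?t # elab_ctx \<Delta> \<Gamma>) (elab (H # \<Gamma>) D)
        (G_cty (Suc ?k) \<epsilon> H' (App (lift (Lam ?t (star_s (H # \<Gamma>) D))) (Var 0)))"
      using G_cty_beta[OF _ res ctx' i] IH t_star_s[OF dm_lam.hyps(2)] False by simp
    then show ?thesis
      using t_lam[OF i] False by (simp add: star_s_simps star_s_body)
  qed
next
  case (dm_app \<Delta> \<epsilon> H H' D1 \<Gamma> f D2 e)
  let ?k = "elab_len \<Gamma>"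
  \<comment> \<open>A result C ! n or A ! \<tau> rules out that the function has an A type.\<close>
  have C: "is_C (TyArr \<epsilon> H H')"
    using dm_app.hyps(1) dm_app.prems is_A_not_C[of H'] by (cases \<epsilon>) (auto simp: wf_H_def)
  have IH1: "has_cty \<Sigma> (elab_ctx \<Delta> \<Gamma>) (elab \<Gamma> D1) (Tot (F_ty ?k (TyArr \<epsilon> H H') (star_s \<Gamma> D1)))"
    using dm_app.IH(1) C by simp
  show ?case
  proof (cases "is_C H")
    case True
    have IH2: "has_cty \<Sigma> (elab_ctx \<Delta> \<Gamma>) (elab \<Gamma> D2) (Tot (F_ty ?k H (star_s \<Gamma> D2)))"
      using dm_app.IH(2) True by simp
    have w2: "has_cty \<Sigma> (elab_ctx \<Delta> \<Gamma>) (star_s \<Gamma> D2) (Tot (star_ty ?k H))"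
      using t_star_s[OF dm_app.hyps(3)] by simp
    have F: "sub (inst (star_s \<Gamma> D2)) (F_ty (Suc ?k) H (Var 0)) = F_ty ?k H (star_s \<Gamma> D2)"
      using F_ty_sub[OF True, of "inst (star_s \<Gamma> D2)" "Suc ?k" ?k] by simp
    have G: "sub_c (up_sub (inst (star_s \<Gamma> D2)))
        (G_cty (Suc (Suc ?k)) \<epsilon> H' (App (lift (lift (star_s \<Gamma> D1))) (Var 1))) =
      G_cty (Suc ?k) \<epsilon> H' (App (lift (star_s \<Gamma> D1)) (lift (star_s \<Gamma> D2)))"
      using G_cty_sub[OF dm_app.prems, of "up_sub (inst (star_s \<Gamma> D2))" "Suc (Suc ?k)" "Suc ?k"] by simp
    have "has_cty \<Sigma> (elab_ctx \<Delta> \<Gamma>) (App (elab \<Gamma> D1) (star_s \<Gamma> D2))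
        (Tot (Pi (F_ty ?k H (star_s \<Gamma> D2))
          (G_cty (Suc ?k) \<epsilon> H' (App (lift (star_s \<Gamma> D1)) (lift (star_s \<Gamma> D2))))))"
      using t_app[OF _ w2] IH1 True F G by fastforce
    \<comment> \<open>The index does not mention y, so instantiating y by the elaborated argument
      leaves it unchanged.\<close>
    from t_app[OF this IH2] show ?thesis
      using True G_cty_inst[OF dm_app.prems, of "elab \<Gamma> D2"] by (simp add: star_s_simps)
  next
    case False
    then have H: "is_A H"
      using dm_app.hyps(1) wf_H_TyArr wf_H_cases by blast
    have "has_cty \<Sigma> (elab_ctx \<Delta> \<Gamma>) (App (elab \<Gamma> D1) (elab \<Gamma> D2))
        (sub_c (inst (elab \<Gamma> D2)) (G_cty (Suc ?k) \<epsilon> H' (App (lift (star_s \<Gamma> D1)) (Var 0))))"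
      using t_app[OF _ t_elab_A[OF dm_app.hyps(3) H]] IH1 False by simp
    then show ?thesis
      using False G_cty_inst[OF dm_app.prems, of "elab \<Gamma> D2"] elab_eq_star_s[OF dm_app.hyps(3) refl H]
      by (simp add: star_s_simps)
  qed
next
  case (dm_pair \<Delta> H H' D1 \<Gamma> e1 D2 e2)
  let ?k = "elab_len \<Gamma>" and ?p = "Pair (star_s \<Gamma> D1) (star_s \<Gamma> D2)"
  have C: "is_C H" "is_C H'"
    using dm_pair.prems by auto
  have tv: "tvars H \<subseteq> {..<\<Delta>}" "tvars H' \<subseteq> {..<\<Delta>}"
    using dm_pair.hyps(1) by (auto simp: wf_H_def)
  have ctx: "ty_ctx \<Sigma> \<Delta> ?k (elab_ctx \<Delta> \<Gamma>)"
    using ty_ctx_elab dm_derives_wf_ctx dm_pair.hyps by blast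
  have w: "has_cty \<Sigma> (elab_ctx \<Delta> \<Gamma>) (star_s \<Gamma> D1) (Tot (star_ty ?k H))"
    "has_cty \<Sigma> (elab_ctx \<Delta> \<Gamma>) (star_s \<Gamma> D2) (Tot (star_ty ?k H'))"
    using t_star_s[OF dm_pair.hyps(2)] t_star_s[OF dm_pair.hyps(3)] by simp_all
  note p = t_pair[OF w]
  \<comment> \<open>The product type built over the index \<open>?p\<close> projects from
    \<open>?p\<close>, so each component's index is expanded to a projection.\<close>
  have "has_cty \<Sigma> (elab_ctx \<Delta> \<Gamma>) (elab \<Gamma> D1) (G_cty ?k Eff_n H (Fst ?p))"
    by (rule G_cty_conv[OF _ _ tv(1) ctx _ _ disjI2[OF red_fst]])
      (use dm_pair.IH(1) C w t_fst[OF p] in simp_all)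
  moreover have "has_cty \<Sigma> (elab_ctx \<Delta> \<Gamma>) (elab \<Gamma> D2) (G_cty ?k Eff_n H' (Snd ?p))"
    by (rule G_cty_conv[OF _ _ tv(2) ctx _ _ disjI2[OF red_snd]])
      (use dm_pair.IH(2) C w t_snd[OF p] in simp_all)
  ultimately show ?case
    by (simp add: star_s_simps t_pair)
next
  case (dm_fst \<Delta> H H' D \<Gamma> e)
  then have "is_C (TyProd H H')"
    using is_A_not_C[of H] by (auto simp: wf_H_def)
  then show ?case
    using dm_fst.IH by (auto simp: star_s_simps intro: t_fst)
next
  case (dm_snd \<Delta> H H' D \<Gamma> e)
  then have "is_C (TyProd H H')"
    using is_A_not_C[of H'] by (auto simp: wf_H_def)
  then show ?case
    using dm_snd.IH by (auto simp: star_s_simps intro: t_snd)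
next
  case (dm_case \<Delta> A A' H \<epsilon> D \<Gamma> e D1 e1 D2 e2)
  let ?k = "elab_len \<Gamma>" and ?w1 = "star_s (A # \<Gamma>) D1" and ?w2 = "star_s (A' # \<Gamma>) D2"
  let ?E = "elab_ctx \<Delta> \<Gamma>" and ?t1 = "star_ty ?k A" and ?t2 = "star_ty ?k A'"
  have A: "is_A A" "is_A A'" "\<not> is_C A" "\<not> is_C A'"
    using dm_case.hyps(1,2) is_A_not_C by (auto simp: wf_A_def)
  have D_eq: "elab \<Gamma> D = star_s \<Gamma> D"
    using elab_eq_star_s[OF dm_case.hyps(4)] A by simp
  have D: "has_cty \<Sigma> ?E (elab \<Gamma> D) (Tot (Sum ?t1 ?t2))"
    using t_elab_A[OF dm_case.hyps(4)] A by simp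
  have IH: "has_cty \<Sigma> (?t1 # ?E) (elab (A # \<Gamma>) D1) (G_cty (Suc ?k) \<epsilon> H ?w1)"
    "has_cty \<Sigma> (?t2 # ?E) (elab (A' # \<Gamma>) D2) (G_cty (Suc ?k) \<epsilon> H ?w2)"
    using dm_case.IH dm_case.prems A by simp_all
  have ctx: "ty_ctx \<Sigma> \<Delta> ?k ?E"
    using ty_ctx_elab dm_derives_wf_ctx dm_case.hyps by blast
  note t1 = t_star_ty_A[OF ctx dm_case.hyps(1)] and t2 = t_star_ty_A[OF ctx dm_case.hyps(2)]
  show ?case
  proof (cases \<epsilon>)
    case Eff_tau
    then have H: "wf_A \<Delta> H" "is_A H" "\<not> is_C H"
      using dm_case.hyps(3) dm_case.prems is_A_not_C by (auto simp: wf_result_def)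
    have "has_cty \<Sigma> ?E (case_nd (star_ty ?k H) (elab \<Gamma> D) (elab (A # \<Gamma>) D1) (elab (A' # \<Gamma>) D2))
        (Pure (star_ty ?k H) (case_nd (wp_ty (star_ty ?k H)) (elab \<Gamma> D) ?w1 ?w2))"
      using IH Eff_tau by (intro t_case_pure[OF D t_star_ty_A[OF ctx H(1)]]) auto
    then show ?thesis
      using H A Eff_tau D_eq by (simp add: star_s_DCase)
  next
    case Eff_n
    then have H: "is_C H" "tvars H \<subseteq> {..<\<Delta>}"
      using dm_case.hyps(3) dm_case.prems by (auto simp: wf_result_def wf_H_def)
    \<comment> \<open>The index as a function of the scrutinee, with its branches weakened by one
      variable: z in the motive, the branch variable when the scrutinee is \<open>Inl x\<close> or
      \<open>Inr x\<close>. The fact \<open>c\<close> is stated for an arbitrary extension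
      \<open>u\<close> to serve all three contexts.\<close>
    let ?c = "\<lambda>z. case_nd (star_ty (Suc ?k) H) z (ren (up_ren Suc) ?w1) (ren (up_ren Suc) ?w2)"
    have w: "has_cty \<Sigma> (?t1 # ?E) ?w1 (Tot (star_ty (Suc ?k) H))"
      "has_cty \<Sigma> (?t2 # ?E) ?w2 (Tot (star_ty (Suc ?k) H))"
      using t_star_s[OF dm_case.hyps(5)] t_star_s[OF dm_case.hyps(6)] A Eff_n by simp_all
    have c: "has_cty \<Sigma> (u # ?E) (?c z) (Tot (star_ty (Suc ?k) H))"
      if u: "has_cty \<Sigma> ?E u (Tot (Univ i))"
        and z: "has_cty \<Sigma> (u # ?E) z (Tot (Sum (lift ?t1) (lift ?t2)))" for u z i
    proof -
      note ctx' = ty_ctx_cons[OF ctx u]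
      obtain j where j: "has_cty \<Sigma> (u # ?E) (star_ty (Suc ?k) H) (Tot (Univ j))"
        using t_star_ty[OF ctx'] H by (auto simp: wf_H_def)
      have "ren (up_ren Suc) (star_ty (Suc ?k) H) = lift (star_ty (Suc ?k) H)"
        using ren_lift[of Suc "star_ty ?k H"] by simp
      then have "has_cty \<Sigma> (lift ?t1 # u # ?E) (ren (up_ren Suc) ?w1) (Tot (lift (star_ty (Suc ?k) H)))"
        "has_cty \<Sigma> (lift ?t2 # u # ?E) (ren (up_ren Suc) ?w2) (Tot (lift (star_ty (Suc ?k) H)))"
        using weakening_under[OF w(1) u] weakening_under[OF w(2) u] by metis+
      moreover have "has_cty \<Sigma> (u # ?E) (lift ?t1) (Tot (Univ 0))" "has_cty \<Sigma> (u # ?E) (lift ?t2) (Tot (Univ 0))"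
        using weakening[OF t1 u] weakening[OF t2 u] by simp_all
      ultimately show ?thesis
        using t_case_nd[OF z] j by blast
    qed
    let ?t = "F_ty (Suc ?k) H (?c (Var 0))"
    have S: "has_cty \<Sigma> ?E (Sum ?t1 ?t2) (Tot (Univ 0))"
      using t_Sum[OF t1 t2] by simp
    obtain l where l: "has_cty \<Sigma> (Sum ?t1 ?t2 # ?E) ?t (Tot (Univ l))"
      using F_ty_wf[OF H(1) ty_ctx_cons[OF ctx S] H(2) c[OF S]] t_var0[OF S] by auto
    \<comment> \<open>The substitution touches only the scrutinee variable, which the weakened
      branches of \<open>?c\<close> do not mention.\<close>
    have sub_t: "sub (inst_under f) ?t = F_ty (Suc ?k) H (?c (f (Var 0)))"
      for f :: "('b, 'k) tm \<Rightarrow> ('b, 'k) tm"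
    proof -
      have "up_sub (inst_under f) \<circ> up_ren Suc = Var \<circ> up_ren Suc"
        by (rule fun_eq_natI) simp_all
      then have "sub (up_sub (inst_under f)) (ren (up_ren Suc) u) = ren (up_ren Suc) u" for u
        by (simp add: sub_ren sub_Var_ren)
      then show ?thesis
        using F_ty_sub[OF H(1), of "inst_under f" "Suc ?k" "Suc ?k"] star_ty_sub[of "inst_under f" "Suc ?k" "Suc ?k"]
        by simp
    qed
    have b1: "has_cty \<Sigma> (?t1 # ?E) (elab (A # \<Gamma>) D1) (G_cty (Suc ?k) Eff_n H (?c (Inl (Var 0))))"
    proof (rule G_cty_conv[OF _ _ H(2) ty_ctx_cons[OF ctx t1], where w = ?w1])
      have "has_cty \<Sigma> (?t1 # ?E) (Inl (Var 0)) (Tot (Sum (lift ?t1) (lift ?t2)))"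
        using t_inl[OF t_var0[OF t1] weakening_ty[OF t2 t1]] by simp
      then show "has_cty \<Sigma> (?t1 # ?E) (?c (Inl (Var 0))) (Tot (res_ty (Suc ?k) Eff_n H))"
        using c[OF t1] by simp
      show "red ?w1 (?c (Inl (Var 0))) \<or> red (?c (Inl (Var 0))) ?w1"
        using red_inl[of _ "Var 0" "ren (up_ren Suc) ?w1"] by (simp add: case_nd_def inst_Var_under)
    qed (use IH w H Eff_n in simp_all)
    have b2: "has_cty \<Sigma> (?t2 # ?E) (elab (A' # \<Gamma>) D2) (G_cty (Suc ?k) Eff_n H (?c (Inr (Var 0))))"
    proof (rule G_cty_conv[OF _ _ H(2) ty_ctx_cons[OF ctx t2], where w = ?w2])
      have "has_cty \<Sigma> (?t2 # ?E) (Inr (Var 0)) (Tot (Sum (lift ?t1) (lift ?t2)))"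
        using t_inr[OF t_var0[OF t2] weakening_ty[OF t1 t2]] by simp
      then show "has_cty \<Sigma> (?t2 # ?E) (?c (Inr (Var 0))) (Tot (res_ty (Suc ?k) Eff_n H))"
        using c[OF t2] by simp
      show "red ?w2 (?c (Inr (Var 0))) \<or> red (?c (Inr (Var 0))) ?w2"
        using red_inr[of _ "Var 0" _ "ren (up_ren Suc) ?w2"] by (simp add: case_nd_def inst_Var_under)
    qed (use IH w H Eff_n in simp_all)
    have "has_cty \<Sigma> ?E (Case ?t (elab \<Gamma> D) (elab (A # \<Gamma>) D1) (elab (A' # \<Gamma>) D2))
        (Tot (sub (inst (elab \<Gamma> D)) ?t))"
      using b1 b2 by (intro t_case[OF D l]) (simp_all only: sub_t G_cty.simps)
    moreover have "sub (inst (elab \<Gamma> D)) ?t =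
        F_ty ?k H (case_nd (star_ty ?k H) (elab \<Gamma> D) ?w1 ?w2)"
    proof -
      have "up_sub (inst (elab \<Gamma> D)) \<circ> up_ren Suc = Var"
        by (rule fun_eq_natI) simp_all
      then have "sub (up_sub (inst (elab \<Gamma> D))) (ren (up_ren Suc) u) = u" for u
        by (simp add: sub_ren)
      then show ?thesis
        using F_ty_sub[OF H(1), of "inst (elab \<Gamma> D)" "Suc ?k" ?k] star_ty_sub[of "inst (elab \<Gamma> D)" "Suc ?k" ?k]
        by simp
    qed
    ultimately show ?thesis
      using H A Eff_n D_eq by (simp add: star_s_DCase)
  qed
next
  case (dm_return \<Delta> A D \<Gamma> e)
  have A: "is_A A"
    using dm_return.hyps(1) by (simp add: wf_A_def)
  have ctx: "ty_ctx \<Sigma> \<Delta> (elab_len \<Gamma>) (elab_ctx \<Delta> \<Gamma>)"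
    using ty_ctx_elab dm_derives_wf_ctx dm_return.hyps by blast
  show ?case
    using t_return[OF t_star_ty_A[OF ctx dm_return.hyps(1)] t_elab_A[OF dm_return.hyps(2) A]]
      elab_eq_star_s[OF dm_return.hyps(2) refl A]
    by (simp add: star_s_simps)
next
  case (dm_bind \<Delta> A A' D1 \<Gamma> e1 D2 e2)
  let ?k = "elab_len \<Gamma>" and ?w1 = "star_s \<Gamma> D1" and ?w2 = "star_s (A # \<Gamma>) D2"
  let ?E = "elab_ctx \<Delta> \<Gamma>" and ?t1 = "star_ty ?k A" and ?t2 = "star_ty ?k A'"
  have A: "is_A A" "is_A A'" "\<not> is_C A" "tvars A' \<subseteq> {..<\<Delta>}"
    using dm_bind.hyps(1,2) is_A_not_C by (auto simp: wf_A_def)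
  have ctx: "ty_ctx \<Sigma> \<Delta> ?k ?E"
    using ty_ctx_elab dm_derives_wf_ctx dm_bind.hyps by blast
  note t1 = t_star_ty_A[OF ctx dm_bind.hyps(1)] and t2 = t_star_ty_A[OF ctx dm_bind.hyps(2)]
  have w2: "has_cty \<Sigma> (?t1 # ?E) ?w2 (Tot (res_ty (Suc ?k) Eff_tau A'))"
    using t_star_s[OF dm_bind.hyps(4)] A by simp
  have W2: "has_cty \<Sigma> ?E (Lam ?t1 ?w2) (Tot (arr ?t1 (wp_ty ?t2)))"
    using t_lam_arr[OF t1] w2 by simp
  have e1: "has_cty \<Sigma> ?E (elab \<Gamma> D1) (Pure ?t1 ?w1)"
    using dm_bind.IH(1) A by simp
  have "has_cty \<Sigma> (?t1 # ?E) (elab (A # \<Gamma>) D2) (G_cty (Suc ?k) Eff_tau A' (App (lift (Lam ?t1 ?w2)) (Var 0)))"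
    using dm_bind.IH(2) A by (intro G_cty_beta[OF _ _ A(4) ty_ctx_cons[OF ctx t1] t1 w2]) simp_all
  then have e2: "has_cty \<Sigma> (?t1 # ?E) (elab (A # \<Gamma>) D2) (Pure (lift ?t2) (App (lift (Lam ?t1 ?w2)) (Var 0)))"
    by simp
  let ?r = "App (lift (Lam ?t1 ?w2)) (Var 0)"
  \<comment> \<open>\<open>t_bind\<close> yields \<open>?b\<close> at the redex \<open>?r\<close>,
    while the star translation is \<open>?b\<close> at its contractum \<open>?w2\<close>; the
    contraction takes place below two binders.\<close>
  let ?b = "\<lambda>w. Lam (pred_ty ?t2) (App (lift ?w1) (Lam (lift ?t1) (App (ren (up_ren Suc) w) (Var 1))))"
  have b: "has_cty \<Sigma> ?E (elab \<Gamma> (DBind A A' D1 D2)) (Pure ?t2 (?b ?r))"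
    using t_bind[OF t1 t2 e1 W2 e2] by (simp del: ren.simps(6))
  have w1: "has_cty \<Sigma> ?E ?w1 (Tot (wp_ty ?t1))"
    using t_star_s[OF dm_bind.hyps(3)] by simp
  have r: "has_cty \<Sigma> (?t1 # ?E) ?r (Tot (wp_ty (lift ?t2)))"
    using t_app_arr[OF _ t_var0[OF t1]] weakening[OF W2 t1] by simp
  have "red ?r ?w2"
    using red_beta[of "lift ?t1" "ren (up_ren Suc) ?w2" "Var 0"] by (simp add: inst_Var_under)
  then have "red (?b ?r) (?b ?w2)"
    by (intro red_Lam2 red_App2 red_App1 red_ren)
  then have "has_cty \<Sigma> ?E (elab \<Gamma> (DBind A A' D1 D2)) (Pure ?t2 (?b ?w2))"
    using pure_conv[OF b t2 t_wp_bind[OF t1 t2 w1 r] t_wp_bind[OF t1 t2 w1]] w2 by simp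
  then show ?case
    by (simp add: star_s_DBind[OF A(3)])
\<comment> \<open>Constants and injections are pure with base or sum types, which are never C
  types.\<close>
qed auto

theorem theorem6:
  fixes \<Sigma> :: "'k \<Rightarrow> 'b list \<times> 'b" and D :: "('b, 'k) deriv" and e :: "('b, 'k) exp"
    and \<Delta> :: nat and \<Gamma> :: "'b ty list" and A C :: "'b ty"
  shows "(is_C C \<longrightarrow> dm_derives \<Sigma> D \<Delta> \<Gamma> e C Eff_n \<longrightarrow>
            has_cty \<Sigma> (elab_ctx \<Delta> \<Gamma>) (elab \<Gamma> D) (Tot (F_ty (elab_len \<Gamma>) C (star_s \<Gamma> D)))) \<and>
         (is_A A \<longrightarrow> dm_derives \<Sigma> D \<Delta> \<Gamma> e A Eff_tau \<longrightarrow>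
            has_cty \<Sigma> (elab_ctx \<Delta> \<Gamma>) (elab \<Gamma> D) (Pure (star_ty (elab_len \<Gamma>) A) (star_s \<Gamma> D)))"
proof (intro conjI impI)
  assume "is_C C" and "dm_derives \<Sigma> D \<Delta> \<Gamma> e C Eff_n"
  then show "has_cty \<Sigma> (elab_ctx \<Delta> \<Gamma>) (elab \<Gamma> D) (Tot (F_ty (elab_len \<Gamma>) C (star_s \<Gamma> D)))"
    using t_elab[of \<Sigma> D \<Delta> \<Gamma> e C Eff_n] by simp
next
  assume "is_A A" and "dm_derives \<Sigma> D \<Delta> \<Gamma> e A Eff_tau"
  then show "has_cty \<Sigma> (elab_ctx \<Delta> \<Gamma>) (elab \<Gamma> D) (Pure (star_ty (elab_len \<Gamma>) A) (star_s \<Gamma> D))"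
    using t_elab[of \<Sigma> D \<Delta> \<Gamma> e A Eff_tau] by simp
qed

end
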